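(* Let $M$ be a finite von Neumann algebra acting on a separable complex Hilbert space $H$, and let $\mathcal S\subset M$ be an abelian set of operators (i.e. any two elements of $\mathcal S$ commute). Assume that $\mathcal S$ is asymptotically controlled by a regular gauge $p$. Then there exists an invertible operator $A\in M$ such that $r(T)^{-1}ATA^{-1}$ is a unitary operator for every $T\in\mathcal S$, where $r(T)$ denotes the spectral radius of $T$.
   Context: $\mathbf N$ denotes the positive integers. A von Neumann algebra $M$ on $H$ (an ultra-weakly closed unital $*$-subalgebra of $B(H)$) is called finite if it admits a faithful normal trace, i.e. an ultra-weakly continuous linear functional $\tau:M\to\mathbf C$ with $\tau(AB)=\tau(BA)$ for all $A,B\in M$, and $\tau(A)\ge 0$ for every positive $A\in M$, with $\tau(A)=0$ only if $A=0$. A bounded complex sequence $(u_n)_{n\ge1}$ is almost convergent to $c$ if $\lim_{n\to\infty}\sup_{k\in\mathbf N}\left|\frac1{n+1}\sum_{i=k}^{k+n}u_i-c\right|=0$; it is strongly almost convergent to $c$ if $(|u_n-c|)_{n\ge1}$ is almost convergent to $0$. A gauge is a mapping $p:\mathbf N\to(0,\infty)$ for which there is $c_p>0$ such that the (bounded) sequence $p(n+1)/p(n)$ is strongly almost convergent to $c_p$. The gauge $p$ is regular if in addition the (bounded) sequence $c_p^n/p(n)$ is strongly almost convergent to $1$. An operator $T$ is compatible with a gauge $p$ if $\|T^n\|\le p(n)$ for every $n\in\mathbf N$ and the sequence $\|T^n\|/p(n)$ does not almost converge to $0$. For a bounded real sequence $\xi$ put $$q'(\xi)=\sup\Big\{\liminf_{k\to\infty}\frac1m\sum_{i=1}^m\xi(n_i+k):\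 m\in\mathbf N,\ n_1,\dots,n_m\in\mathbf N\Big\}.$$ Put $Q_1=q'$. For $n>1$ and a real $\xi\in\ell^\infty(\mathbf N^n)$, let $Q_n\xi\in\ell^\infty(\mathbf N^{n-1})$ be defined by $(Q_n\xi)(j_1,\dots,j_{n-1})=q'(\xi_{j_1,\dots,j_{n-1}})$, where $\xi_{j_1,\dots,j_{n-1}}(j)=\xi(j_1,\dots,j_{n-1},j)$. Let $\widetilde Q_n=Q_1\circ Q_2\circ\cdots\circ Q_n$, a real-valued functional on real sequences in $\ell^\infty(\mathbf N^n)$. A set $\mathcal F$ of operators on $H$ is asymptotically controlled by a gauge $p$ if every operator in $\mathcal F$ is compatible with $p$ and for every nonzero $x\in H$ there exists $\rho(x)>0$ such that $$\widetilde Q_n\left(\left\{\frac{1}{p(j_1)^2\cdots p(j_n)^2}\left\langle T_n^{*j_n}\cdots T_1^{*j_1}T_1^{j_1}\cdots T_n^{j_n}x,x\right\rangle\right\}_{j_1,\dots,j_n=1}^\infty\right)\ge\rho(x)$$ for every $n\in\mathbf N$ and all $T_1,\dots,T_n\in\mathcal F$. *)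

theory Defs
  imports "HOL-Analysis.Analysis"
begin

section \<open>Complex Hilbert spaces\<close>

text \<open>
  The underlying real Hilbert space structure is the one of \<^class>\<open>real_inner\<close>; its inner product
  is the real part of the complex one, so the norm is the norm of \<open>cinner\<close>.
  The complex inner product is linear in the first argument.
\<close>

class complex_inner = real_inner +
  fixes scaleC :: "complex \<Rightarrow> 'a \<Rightarrow> 'a"  (infixr \<open>*\<^sub>C\<close> 75)
    and cinner :: "'a \<Rightarrow> 'a \<Rightarrow> complex"
  assumes scaleC_add_right: "c *\<^sub>C (x + y) = c *\<^sub>C x + c *\<^sub>C y"
    and scaleC_add_left: "(b + c) *\<^sub>C x = b *\<^sub>C x + c *\<^sub>C x"
    and scaleC_scaleC: "b *\<^sub>C (c *\<^sub>C x) = (b * c) *\<^sub>C x"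
    and scaleC_of_real: "complex_of_real r *\<^sub>C x = r *\<^sub>R x"
    and cinner_commute: "cinner x y = cnj (cinner y x)"
    and cinner_add_left: "cinner (x + y) z = cinner x z + cinner y z"
    and cinner_scaleC_left: "cinner (c *\<^sub>C x) y = c * cinner x y"
    and inner_eq_Re_cinner: "inner x y = Re (cinner x y)"

class chilbert_space = complex_inner + complete_space

instantiation complex :: chilbert_space
begin

definition scaleC_complex :: "complex \<Rightarrow> complex \<Rightarrow> complex" where
  "scaleC_complex c x = c * x"

definition cinner_complex :: "complex \<Rightarrow> complex \<Rightarrow> complex" where
  "cinner_complex x y = x * cnj y"

instance
  by standard (simp_all add: scaleC_complex_def cinner_complex_def algebra_simps scaleR_conv_of_real
      inner_complex_def)

end

section \<open>Bounded operators\<close>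

text \<open>
  Operators on \<open>H\<close> are functions \<open>H \<Rightarrow> H\<close> satisfying \<open>bounded_clinear\<close>. The product is composition,
  \<open>T ^^ n\<close> is the \<open>n\<close>-th power and \<^const>\<open>onorm\<close> is the operator norm.
\<close>

definition bounded_clinear :: "('a::complex_inner \<Rightarrow> 'a) \<Rightarrow> bool" where
  "bounded_clinear T \<longleftrightarrow> bounded_linear T \<and> (\<forall>c x. T (c *\<^sub>C x) = c *\<^sub>C T x)"

definition cadjoint :: "('a::complex_inner \<Rightarrow> 'a) \<Rightarrow> ('a \<Rightarrow> 'a)" where
  "cadjoint T = (THE S. \<forall>x y. cinner (S x) y = cinner x (T y))"

definition invertible_operator :: "('a::complex_inner \<Rightarrow> 'a) \<Rightarrow> bool" where
  "invertible_operator T \<longleftrightarrow>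
     bounded_clinear T \<and> (\<exists>S. bounded_clinear S \<and> S \<circ> T = id \<and> T \<circ> S = id)"

definition unitary_operator :: "('a::complex_inner \<Rightarrow> 'a) \<Rightarrow> bool" where
  "unitary_operator U \<longleftrightarrow>
     bounded_clinear U \<and> cadjoint U \<circ> U = id \<and> U \<circ> cadjoint U = id"

definition positive_operator :: "('a::complex_inner \<Rightarrow> 'a) \<Rightarrow> bool" where
  "positive_operator T \<longleftrightarrow> bounded_clinear T \<and> (\<forall>x. cinner (T x) x \<in> \<real>\<^sub>\<ge>\<^sub>0)"

definition spectrum :: "('a::complex_inner \<Rightarrow> 'a) \<Rightarrow> complex set" where
  "spectrum T = {z. \<not> invertible_operator (\<lambda>x. T x - z *\<^sub>C x)}"

text \<open>On the zero space the spectrum is empty and the value of \<open>spectral_radius\<close> is unspecified.\<close>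

definition spectral_radius :: "('a::complex_inner \<Rightarrow> 'a) \<Rightarrow> real" where
  "spectral_radius T = (SUP z\<in>spectrum T. cmod z)"

section \<open>Finite von Neumann algebras\<close>

text \<open>
  The ultra-weak topology is the coarsest topology on the bounded operators that makes all
  functionals \<open>T \<mapsto> \<Sum>n. \<langle>T x\<^sub>n, y\<^sub>n\<rangle>\<close> with
  \<open>\<Sum>n. \<parallel>x\<^sub>n\<parallel>\<^sup>2 < \<infinity>\<close> and \<open>\<Sum>n. \<parallel>y\<^sub>n\<parallel>\<^sup>2 < \<infinity>\<close> continuous.
\<close>

definition ultraweak_topology :: "('a::complex_inner \<Rightarrow> 'a) topology" where
  "ultraweak_topology = topology_generated_by
     {{T. bounded_clinear T \<and> (\<Sum>n. cinner (T (x n)) (y n)) \<in> U} | x y U.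
        summable (\<lambda>n. (norm (x n))\<^sup>2) \<and> summable (\<lambda>n. (norm (y n))\<^sup>2) \<and> open U}"

definition von_neumann_algebra :: "('a::complex_inner \<Rightarrow> 'a) set \<Rightarrow> bool" where
  "von_neumann_algebra M \<longleftrightarrow>
     M \<subseteq> Collect bounded_clinear \<and> id \<in> M \<and>
     (\<forall>S\<in>M. \<forall>T\<in>M. (\<lambda>x. S x + T x) \<in> M) \<and>
     (\<forall>c. \<forall>T\<in>M. (\<lambda>x. c *\<^sub>C T x) \<in> M) \<and>
     (\<forall>S\<in>M. \<forall>T\<in>M. S \<circ> T \<in> M) \<and>
     (\<forall>T\<in>M. cadjoint T \<in> M) \<and>
     closedin ultraweak_topology M"

definition faithful_normal_trace ::
    "('a::complex_inner \<Rightarrow> 'a) set \<Rightarrow> (('a \<Rightarrow> 'a) \<Rightarrow> complex) \<Rightarrow> bool" where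
  "faithful_normal_trace M \<tau> \<longleftrightarrow>
     (\<forall>A\<in>M. \<forall>B\<in>M. \<tau> (\<lambda>x. A x + B x) = \<tau> A + \<tau> B) \<and>
     (\<forall>c. \<forall>A\<in>M. \<tau> (\<lambda>x. c *\<^sub>C A x) = c * \<tau> A) \<and>
     continuous_map (subtopology ultraweak_topology M) euclidean \<tau> \<and>
     (\<forall>A\<in>M. \<forall>B\<in>M. \<tau> (A \<circ> B) = \<tau> (B \<circ> A)) \<and>
     (\<forall>A\<in>M. positive_operator A \<longrightarrow> \<tau> A \<in> \<real>\<^sub>\<ge>\<^sub>0 \<and> (\<tau> A = 0 \<longrightarrow> A = (\<lambda>x. 0)))"

definition finite_von_neumann_algebra :: "('a::complex_inner \<Rightarrow> 'a) set \<Rightarrow> bool" where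
  "finite_von_neumann_algebra M \<longleftrightarrow>
     von_neumann_algebra M \<and> (\<exists>\<tau>. faithful_normal_trace M \<tau>)"

section \<open>Almost convergence and gauges\<close>

text \<open>
  Sequences are indexed by the positive integers: the value at \<open>0\<close> of a function on \<^typ>\<open>nat\<close> is
  never used below. Boundedness is part of (strong) almost convergence.
\<close>

definition almost_convergent_to :: "(nat \<Rightarrow> 'a::real_normed_vector) \<Rightarrow> 'a \<Rightarrow> bool" where
  "almost_convergent_to u c \<longleftrightarrow>
     bounded (u ` {1..}) \<and>
     (\<lambda>n. SUP k\<in>{1..}. norm ((1 / real (n + 1)) *\<^sub>R (\<Sum>i=k..k+n. u i) - c)) \<longlonglongrightarrow> 0"

definition strongly_almost_convergent_to :: "(nat \<Rightarrow> 'a::real_normed_vector) \<Rightarrow> 'a \<Rightarrow> bool" where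
  "strongly_almost_convergent_to u c \<longleftrightarrow>
     bounded (u ` {1..}) \<and> almost_convergent_to (\<lambda>n. norm (u n - c)) 0"

definition norm_gauge_with :: "(nat \<Rightarrow> real) \<Rightarrow> real \<Rightarrow> bool" where
  "norm_gauge_with p c \<longleftrightarrow>
     (\<forall>n\<ge>1. 0 < p n) \<and> 0 < c \<and> strongly_almost_convergent_to (\<lambda>n. p (n + 1) / p n) c"

text \<open>Called a gauge in the literature; \<^const>\<open>gauge\<close> is the Henstock--Kurzweil notion.\<close>

definition norm_gauge :: "(nat \<Rightarrow> real) \<Rightarrow> bool" where
  "norm_gauge p \<longleftrightarrow> (\<exists>c. norm_gauge_with p c)"

text \<open>Almost limits are unique, so \<open>c\<close> is determined by \<open>p\<close>.\<close>

definition regular_norm_gauge :: "(nat \<Rightarrow> real) \<Rightarrow> bool" where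
  "regular_norm_gauge p \<longleftrightarrow>
     (\<exists>c. norm_gauge_with p c \<and> strongly_almost_convergent_to (\<lambda>n. c ^ n / p n) 1)"

definition gauge_compatible :: "('a::complex_inner \<Rightarrow> 'a) \<Rightarrow> (nat \<Rightarrow> real) \<Rightarrow> bool" where
  "gauge_compatible T p \<longleftrightarrow>
     bounded_clinear T \<and> (\<forall>n\<ge>1. onorm (T ^^ n) \<le> p n) \<and>
     \<not> almost_convergent_to (\<lambda>n. onorm (T ^^ n) / p n) 0"

section \<open>Asymptotic control\<close>

text \<open>
  For a sequence that is bounded on the positive integers the lower limits are finite and
  uniformly bounded, so the conversion from \<^typ>\<open>ereal\<close> and the real supremum are harmless.
\<close>

definition q_prime :: "(nat \<Rightarrow> real) \<Rightarrow> real" where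
  "q_prime \<xi> = Sup {real_of_ereal (liminf (\<lambda>k. ereal ((1 / real m) * (\<Sum>i=1..m. \<xi> (\<nu> i + k))))) | m \<nu>.
     1 \<le> m \<and> (\<forall>i\<in>{1..m}. (1::nat) \<le> \<nu> i)}"

text \<open>
  A function of \<open>n\<close> indices is a function on lists, evaluated at lists of length \<open>n\<close> only.
  \<open>Q_last\<close> applies \<open>q_prime\<close> in the last index (the operator \<open>Q\<^sub>n\<close>, for every \<open>n\<close>), and
  \<open>Q_tilde n\<close> is the composition \<open>Q\<^sub>1 \<circ> \<dots> \<circ> Q\<^sub>n\<close>, a function of no index being the scalar at \<open>[]\<close>.
\<close>

definition Q_last :: "(nat list \<Rightarrow> real) \<Rightarrow> (nat list \<Rightarrow> real)" where
  "Q_last \<xi> = (\<lambda>js. q_prime (\<lambda>j. \<xi> (js @ [j])))"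

definition Q_tilde :: "nat \<Rightarrow> (nat list \<Rightarrow> real) \<Rightarrow> real" where
  "Q_tilde n \<xi> = (Q_last ^^ n) \<xi> []"

text \<open>
  With \<open>Ts = [T\<^sub>1, \<dots>, T\<^sub>n]\<close> and \<open>js = [j\<^sub>1, \<dots>, j\<^sub>n]\<close>, the \<^const>\<open>foldr\<close> gives
  \<open>T\<^sub>1\<^bsup>j\<^sub>1\<^esup> \<cdots> T\<^sub>n\<^bsup>j\<^sub>n\<^esup> x\<close>, and the \<^const>\<open>fold\<close> then applies
  \<open>T\<^sub>n\<^bsup>*j\<^sub>n\<^esup> \<cdots> T\<^sub>1\<^bsup>*j\<^sub>1\<^esup>\<close> to it. The inner product is real (and nonnegative), so
  \<^const>\<open>Re\<close> only converts its type.
\<close>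

definition control_sequence ::
    "(nat \<Rightarrow> real) \<Rightarrow> ('a::complex_inner \<Rightarrow> 'a) list \<Rightarrow> 'a \<Rightarrow> nat list \<Rightarrow> real" where
  "control_sequence p Ts x js =
     1 / (\<Prod>j\<leftarrow>js. (p j)\<^sup>2) *
     Re (cinner (fold (\<lambda>(T, j). cadjoint T ^^ j) (zip Ts js)
                  (foldr (\<lambda>(T, j). T ^^ j) (zip Ts js) x)) x)"

definition asymptotically_controlled ::
    "('a::complex_inner \<Rightarrow> 'a) set \<Rightarrow> (nat \<Rightarrow> real) \<Rightarrow> bool" where
  "asymptotically_controlled F p \<longleftrightarrow>
     (\<forall>T\<in>F. gauge_compatible T p) \<and>
     (\<forall>x. x \<noteq> 0 \<longrightarrow> (\<exists>\<rho>>0. \<forall>n\<ge>1. \<forall>Ts. length Ts = n \<and> set Ts \<subseteq> F \<longrightarrow>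
        Q_tilde n (control_sequence p Ts x) \<ge> \<rho>))"

end

(*
  Fix T in S, let c be the almost limit of p(n+1)/p(n), and put U = T/c and w(n) = c^n/p(n). Already U itself
  is unitary, so r(T) = c and A = 1 works. Indeed w(n) ||U^n|| <= 1, and w is close to 1 on most of
  every long window, so U is power bounded; the control condition for n = 1 then keeps the orbits of U
  away from 0. A weak limit B of Cesaro means of U*^i U^i is thus injective, positive and satisfies
  U* B U = B, and tr(B P) >= 0 for positive P in M. For a weak limit Y of the positive contractions
  1 - w(n)^2 U^n U*^n along n with w(n) -> 1, the trace property gives
  tr(B Y) = lim (1 - w(n)^2) tr(B) = 0; as Y - Y^2 >= 0, also tr(Y B Y) = tr(B Y^2) = 0, whence Y = 0.
  So U^n U*^n -> 1 weakly, both along such n and along their successors, which forces U U* = 1;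
  finiteness of M then gives U* U = 1.
*)

theory Submission
  imports Defs "HOL-Complex_Analysis.Cauchy_Integral_Formula"
begin

text \<open>Nothing says at the outset that U is a contraction: the gauge bounds U^n by a number
  close to 1 only at times where w(n) is close to 1. Hence the comparison at two such times in a
  row, n and n + 1, which strong almost convergence provides. The order of the factors in U^n U*^n
  matters: cyclicity of the trace turns tr(B U^n U*^n) into tr(U*^n B U^n) = tr(B), an exact
  identity for every n. Operator square roots are avoided. The inequality tr(B P) >= 0 passes to B
  from the means, since tr(U*^i U^i P) = tr(U^i P U*^i). And B Y need not be positive, so that
  faithfulness says nothing about tr(B Y) = 0; this is why Y^2 enters, with tr(B Y^2) = tr(Y B Y)
  the trace of a positive operator. Multiplication is not jointly continuous for weak operator
  limits, so only products with fixed operators are ever passed to the limit. On norm-bounded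
  families these limits are ultraweak, which is what lets normality of the trace apply.\<close>

section \<open>Complex inner product spaces\<close>

lemma cinner_add_right: "cinner x (y + z) = cinner x y + cinner x z"
  by (metis cinner_add_left cinner_commute complex_cnj_add)

lemma cinner_scaleC_right: "cinner x (c *\<^sub>C y) = cnj c * cinner x y"
  by (metis cinner_commute cinner_scaleC_left complex_cnj_mult)

lemma scaleR_eq_scaleC: "r *\<^sub>R x = complex_of_real r *\<^sub>C x"
  by (simp add: scaleC_of_real)

lemma cinner_scaleR_left: "cinner (r *\<^sub>R x) y = complex_of_real r * cinner x y"
  by (simp add: scaleR_eq_scaleC cinner_scaleC_left)

lemma cinner_scaleR_right: "cinner x (r *\<^sub>R y) = complex_of_real r * cinner x y"
  by (simp add: scaleR_eq_scaleC cinner_scaleC_right)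

lemma cinner_zero_left [simp]: "cinner 0 y = 0"
  using cinner_scaleR_left[of 0 0 y] by simp

lemma cinner_zero_right [simp]: "cinner x 0 = 0"
  using cinner_scaleR_right[of x 0 0] by simp

lemma cinner_minus_left: "cinner (- x) y = - cinner x y"
  using cinner_scaleR_left[of "-1" x y] by simp

lemma cinner_minus_right: "cinner x (- y) = - cinner x y"
  using cinner_scaleR_right[of x "-1" y] by simp

lemma cinner_diff_left: "cinner (x - y) z = cinner x z - cinner y z"
  using cinner_add_left[of x "-y" z] by (simp add: cinner_minus_left)

lemma cinner_diff_right: "cinner x (y - z) = cinner x y - cinner x z"
  using cinner_add_right[of x y "-z"] by (simp add: cinner_minus_right)

lemma cinner_sum_left: "cinner (\<Sum>i\<in>I. f i) y = (\<Sum>i\<in>I. cinner (f i) y)"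
  by (induction I rule: infinite_finite_induct) (auto simp: cinner_add_left)

lemma scaleC_one [simp]: "1 *\<^sub>C x = x"
  using scaleC_of_real[of 1 x] by simp

lemma scaleC_zero_left [simp]: "0 *\<^sub>C x = 0"
  using scaleC_of_real[of 0 x] by simp

lemma scaleC_minus_left: "(- c) *\<^sub>C x = - (c *\<^sub>C x)"
  using scaleC_add_left[of "-c" c x] by (simp add: eq_neg_iff_add_eq_0)

lemma scaleC_minus_right: "c *\<^sub>C (- x) = - (c *\<^sub>C x)"
  using scaleC_scaleC[of c "-1" x] scaleC_scaleC[of "-1" c x]
  by (simp add: scaleC_minus_left)

lemma scaleC_diff_left: "(b - c) *\<^sub>C x = b *\<^sub>C x - c *\<^sub>C x"
  using scaleC_add_left[of b "-c" x] by (simp add: scaleC_minus_left)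

lemma scaleC_diff_right: "c *\<^sub>C (x - y) = c *\<^sub>C x - c *\<^sub>C y"
  using scaleC_add_right[of c x "-y"] by (simp add: scaleC_minus_right)

lemma cinner_self: "cinner x x = complex_of_real ((norm x)\<^sup>2)"
proof (rule complex_eqI)
  show "Im (cinner x x) = Im (complex_of_real ((norm x)\<^sup>2))"
    using arg_cong[OF cinner_commute[of x x], of Im] by simp
  show "Re (cinner x x) = Re (complex_of_real ((norm x)\<^sup>2))"
    by (simp flip: inner_eq_Re_cinner add: power2_norm_eq_inner)
qed

lemma norm_scaleC: "norm (c *\<^sub>C x) = cmod c * norm x"
proof -
  have "complex_of_real ((norm (c *\<^sub>C x))\<^sup>2) = complex_of_real ((cmod c * norm x)\<^sup>2)"
    unfolding cinner_self[symmetric] cinner_scaleC_left cinner_scaleC_right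
    using complex_norm_square[of c] by (simp add: cinner_self power_mult_distrib mult.commute[of _ c] flip: mult.assoc)
  then have "(norm (c *\<^sub>C x))\<^sup>2 = (cmod c * norm x)\<^sup>2"
    by (simp only: of_real_eq_iff)
  then show ?thesis
    by (rule power2_eq_imp_eq) auto
qed

text \<open>Rotating \<open>x\<close> by the conjugate phase \<open>u\<close> makes the inner
  product real and nonnegative, hence equal to a value of \<open>inner\<close>, where the real
  Cauchy-Schwarz inequality applies.\<close>

lemma cinner_norm_le: "cmod (cinner x y) \<le> norm x * norm y"
proof -
  define u where "u = cnj (sgn (cinner x y))"
  have "u * cinner x y = complex_of_real (cmod (cinner x y))"
    using complex_norm_square[of "cinner x y"]
    by (cases "cinner x y = 0") (auto simp: u_def sgn_eq power2_eq_square field_simps)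
  then have "cmod (cinner x y) = inner (u *\<^sub>C x) y"
    by (simp add: inner_eq_Re_cinner cinner_scaleC_left)
  also have "\<dots> \<le> norm (u *\<^sub>C x) * norm y"
    by (rule norm_cauchy_schwarz)
  also have "\<dots> \<le> norm x * norm y"
    by (auto simp: norm_scaleC u_def norm_sgn)
  finally show ?thesis .
qed

lemma cinner_ext_left: "(\<And>y. cinner x y = cinner x' y) \<Longrightarrow> x = x'"
proof -
  assume "\<And>y. cinner x y = cinner x' y"
  then have "cinner (x - x') (x - x') = 0"
    by (simp add: cinner_diff_left)
  then show ?thesis
    by (simp add: cinner_self)
qed

text \<open>The representing vector minimizes the energy \<open>J\<close>: the parallelogram law
  makes a minimizing sequence Cauchy, and the first variation at its limit is the claimed
  identity.\<close>

lemma riesz_representation_real: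
  fixes f :: "'a::{real_inner,complete_space} \<Rightarrow> real"
  assumes "bounded_linear f"
  shows "\<exists>z. \<forall>x. f x = inner z x"
proof -
  interpret f: bounded_linear f by fact
  obtain C where C: "\<And>x. norm (f x) \<le> norm x * C"
    using f.bounded by blast
  define J where "J u = (norm u)\<^sup>2 / 2 - f u" for u
  define d where "d = Inf (range J)"
  have J_lower: "- C\<^sup>2 / 2 \<le> J u" for u
  proof -
    have "0 \<le> (norm u - C)\<^sup>2" by simp
    then show ?thesis
      using C[of u] unfolding J_def power2_diff by (simp add: field_simps)
  qed
  then have bdd: "bdd_below (range J)"
    by (auto simp: bdd_below_def)
  have d_le: "d \<le> J u" for u
    unfolding d_def by (rule cInf_lower[OF _ bdd]) simp
  have "\<exists>u. J u < d + 1 / Suc n" for n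
    using cInf_lessD[of "range J" "d + 1 / Suc n"] unfolding d_def[symmetric] by auto
  then obtain u where u: "\<And>n. J (u n) < d + 1 / Suc n"
    by metis
  \<comment> \<open>The midpoint \<open>m\<close> has energy at least \<open>d\<close>, so two
    near-minimizers are as close as their excess energies are small.\<close>
  have parallelogram: "(norm (v - w))\<^sup>2 \<le> 4 * (J v + J w - 2 * d)" for v w
  proof -
    define m where "m = (1/2) *\<^sub>R (v + w)"
    have "(norm (v - w))\<^sup>2 / 4 = J v + J w - 2 * J m"
      unfolding J_def m_def f.scaleR f.add power2_norm_eq_inner
      by (simp add: inner_simps inner_commute[of w v]) argo
    then show ?thesis
      using d_le[of m] by argo
  qed
  have "Cauchy u"
  proof (rule metric_CauchyI)
    fix e :: real assume e: "0 < e"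
    obtain N where N: "8 / e\<^sup>2 < real N"
      using reals_Archimedean2 by blast
    show "\<exists>M. \<forall>m\<ge>M. \<forall>n\<ge>M. dist (u m) (u n) < e"
    proof (intro exI allI impI)
      fix m n assume "N \<le> m" "N \<le> n"
      then have "1 / real (Suc m) \<le> 1 / real (Suc N)" "1 / real (Suc n) \<le> 1 / real (Suc N)"
        by (auto simp: field_simps)
      then have "(norm (u m - u n))\<^sup>2 < 8 / real (Suc N)"
        using parallelogram[of "u m" "u n"] u[of m] u[of n] by simp
      also have "\<dots> < e\<^sup>2"
      proof -
        have "8 < real N * e\<^sup>2"
          using N e by (simp add: field_simps)
        also have "\<dots> \<le> real (Suc N) * e\<^sup>2"
          by (intro mult_right_mono) auto
        finally show ?thesis
          by (simp only: divide_less_eq mult.commute of_nat_0_less_iff zero_less_Suc if_True)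
      qed
      finally show "dist (u m) (u n) < e"
        using e by (simp add: dist_norm power_less_imp_less_base)
    qed
  qed
  then obtain z where z: "u \<longlonglongrightarrow> z"
    using Cauchy_convergent convergent_def by blast
  have "(\<lambda>n. J (u n)) \<longlonglongrightarrow> J z"
    unfolding J_def by (intro tendsto_intros f.tendsto z) auto
  moreover have "(\<lambda>n. d + 1 / Suc n) \<longlonglongrightarrow> d + 0"
    using LIMSEQ_inverse_real_of_nat by (intro tendsto_intros) (simp add: inverse_eq_divide)
  ultimately have Jz: "J z \<le> d"
    using u by (auto intro: LIMSEQ_le less_imp_le)
  have "f y = inner z y" for y
  proof (rule ccontr)
    assume *: "f y \<noteq> inner z y"
    define a where "a = inner z y - f y"
    define N where "N = (norm y)\<^sup>2"
    \<comment> \<open>Along \<open>y\<close> the energy changes by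
      \<open>t * a + t\<^sup>2 * N / 2\<close>. The optimal \<open>t\<close> is
      \<open>- a / N\<close>; the denominator \<open>N + 1\<close> still gives a decrease and cannot
      vanish.\<close>
    define t where "t = - a / (N + 1)"
    have N: "0 \<le> N" by (simp add: N_def)
    have "J (z + t *\<^sub>R y) = J z + t * a + t\<^sup>2 * N / 2"
      unfolding J_def f.scaleR f.add a_def N_def power2_norm_eq_inner
      by (simp add: inner_simps inner_commute[of y z] power2_eq_square) algebra
    then have "0 \<le> t * a + t\<^sup>2 * N / 2"
      using d_le[of "z + t *\<^sub>R y"] Jz by linarith
    also have "\<dots> = - (a\<^sup>2 / (N + 1)\<^sup>2) * (N / 2 + 1)"
      using N by (simp add: t_def power2_eq_square field_simps add_nonneg_eq_0_iff)
    finally have "a\<^sup>2 / (N + 1)\<^sup>2 * (N / 2 + 1) \<le> 0"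
      by simp
    moreover have "0 < a\<^sup>2 / (N + 1)\<^sup>2 * (N / 2 + 1)"
      using * N by (intro mult_pos_pos divide_pos_pos) (auto simp: a_def)
    ultimately show False by linarith
  qed
  then show ?thesis by blast
qed

text \<open>A complex-linear functional is determined by its real part, because Im f(x) = - Re
  f(ix); the real theorem is applied to Re f.\<close>

lemma riesz_representation:
  fixes f :: "'a::chilbert_space \<Rightarrow> complex"
  assumes add: "\<And>x y. f (x + y) = f x + f y"
    and scale: "\<And>c x. f (c *\<^sub>C x) = c * f x"
    and bound: "\<And>x. cmod (f x) \<le> K * norm x"
  shows "\<exists>z. \<forall>x. f x = cinner x z"
proof -
  have "bounded_linear (\<lambda>x. Re (f x))"
  proof (rule bounded_linear_intro[where K = K])
    show "norm (Re (f x)) \<le> norm x * K" for x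
      using bound[of x] abs_Re_le_cmod[of "f x"] by (simp add: mult.commute)
  qed (simp_all add: add scale scaleR_eq_scaleC)
  then obtain z where z: "\<And>x. Re (f x) = inner z x"
    using riesz_representation_real by blast
  then have Re: "Re (f x) = Re (cinner x z)" for x
    by (metis inner_commute inner_eq_Re_cinner)
  have "Im (f x) = Im (cinner x z)" for x
    using Re[of "\<i> *\<^sub>C x"] by (simp add: scale cinner_scaleC_left)
  with Re have "f x = cinner x z" for x
    by (simp add: complex_eqI)
  then show ?thesis by blast
qed

section \<open>Bounded operators\<close>

lemma bounded_clinearI:
  assumes "\<And>x y. T (x + y) = T x + T y" "\<And>c x. T (c *\<^sub>C x) = c *\<^sub>C T x"
    and "\<And>x. norm (T x) \<le> K * norm x"
  shows "bounded_clinear T"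
  unfolding bounded_clinear_def
  using assms by (auto intro!: bounded_linear_intro[where K = K] simp: scaleR_eq_scaleC mult.commute)

lemma bounded_clinear_bounded_linear: "bounded_clinear T \<Longrightarrow> bounded_linear T"
  by (simp add: bounded_clinear_def)

lemma bounded_clinear_add: "bounded_clinear T \<Longrightarrow> T (x + y) = T x + T y"
  by (simp add: bounded_clinear_def linear_simps)

lemma bounded_clinear_diff: "bounded_clinear T \<Longrightarrow> T (x - y) = T x - T y"
  by (simp add: bounded_clinear_def linear_simps)

lemma bounded_clinear_zero: "bounded_clinear T \<Longrightarrow> T 0 = 0"
  by (simp add: bounded_clinear_def linear_simps)

lemma bounded_clinear_scaleC: "bounded_clinear T \<Longrightarrow> T (c *\<^sub>C x) = c *\<^sub>C T x"
  by (simp add: bounded_clinear_def)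

lemma bounded_clinear_scaleR: "bounded_clinear T \<Longrightarrow> T (r *\<^sub>R x) = r *\<^sub>R T x"
  by (simp add: bounded_clinear_def linear_simps)

lemma bounded_clinear_bound:
  assumes "bounded_clinear T"
  obtains K where "0 \<le> K" "\<And>x. norm (T x) \<le> K * norm x"
  using bounded_linear.nonneg_bounded[OF bounded_clinear_bounded_linear[OF assms]]
  by (auto simp: mult.commute)

lemma bounded_clinear_id: "bounded_clinear id"
  by (rule bounded_clinearI[where K = 1]) auto

lemma bounded_clinear_compose:
  assumes "bounded_clinear S" "bounded_clinear T"
  shows "bounded_clinear (S \<circ> T)"
  using assms bounded_linear_compose[of S T] by (auto simp: bounded_clinear_def o_def)

lemma bounded_clinear_scaleC_op:
  assumes "bounded_clinear T"
  shows "bounded_clinear (\<lambda>x. c *\<^sub>C T x)"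
proof -
  obtain K where K: "0 \<le> K" "\<And>x. norm (T x) \<le> K * norm x"
    using assms by (rule bounded_clinear_bound) blast
  show ?thesis
  proof (rule bounded_clinearI[where K = "cmod c * K"])
    show "norm (c *\<^sub>C T x) \<le> cmod c * K * norm x" for x
      using mult_left_mono[OF K(2)[of x], of "cmod c"] by (simp add: norm_scaleC mult.assoc)
  qed (simp_all add: bounded_clinear_add[OF assms] bounded_clinear_scaleC[OF assms]
      scaleC_add_right scaleC_scaleC mult.commute)
qed

lemma bounded_clinear_add_op:
  assumes "bounded_clinear S" "bounded_clinear T"
  shows "bounded_clinear (\<lambda>x. S x + T x)"
  using assms bounded_linear_add[of S T] by (auto simp: bounded_clinear_def scaleC_add_right)

text \<open>Riesz representation in the second argument, for each fixed \<open>x\<close>. This is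
  the source of both adjoints and weak operator limits.\<close>

lemma bounded_sesquilinear_form_operator:
  fixes b :: "'a::chilbert_space \<Rightarrow> 'a \<Rightarrow> complex"
  assumes add1: "\<And>x x' y. b (x + x') y = b x y + b x' y"
    and add2: "\<And>x y y'. b x (y + y') = b x y + b x y'"
    and scale1: "\<And>c x y. b (c *\<^sub>C x) y = c * b x y"
    and scale2: "\<And>c x y. b x (c *\<^sub>C y) = cnj c * b x y"
    and bound: "\<And>x y. cmod (b x y) \<le> K * norm x * norm y"
  obtains X where "bounded_clinear X" "\<And>x. norm (X x) \<le> K * norm x"
    "\<And>x y. b x y = cinner (X x) y"
proof -
  have "\<exists>z. \<forall>y. cnj (b x y) = cinner y z" for x
    by (rule riesz_representation[where K = "K * norm x"]) (simp_all add: add2 scale2 bound)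
  then have "\<exists>z. \<forall>y. b x y = cinner z y" for x
    by (metis cinner_commute complex_cnj_cnj)
  then obtain X where X: "\<And>x y. b x y = cinner (X x) y"
    by metis
  have norm: "norm (X x) \<le> K * norm x" for x
  proof (cases "X x = 0")
    case True
    have "0 \<le> K * norm x * norm x"
      using order.trans[OF norm_ge_zero bound] .
    with True show ?thesis
      by (cases "x = 0") (auto simp: zero_le_mult_iff)
  next
    case False
    have "norm (X x) * norm (X x) \<le> K * norm x * norm (X x)"
      using bound[of x "X x"] by (simp add: X cinner_self power2_eq_square norm_mult)
    with False show ?thesis by simp
  qed
  have "bounded_clinear X"
  proof (rule bounded_clinearI[OF _ _ norm])
    show "X (x + y) = X x + X y" for x y
      by (rule cinner_ext_left) (simp add: cinner_add_left add1 flip: X)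
    show "X (c *\<^sub>C x) = c *\<^sub>C X x" for c x
      by (rule cinner_ext_left) (simp add: cinner_scaleC_left scale1 flip: X)
  qed
  with norm X that show thesis by blast
qed

section \<open>Adjoints and positive operators\<close>

lemma cadjoint_eqI:
  assumes "\<And>x y. cinner (S x) y = cinner x (T y)"
  shows "cadjoint T = S"
  unfolding cadjoint_def
proof (rule the_equality)
  show "\<forall>x y. cinner (S x) y = cinner x (T y)"
    using assms by blast
  fix S' assume "\<forall>x y. cinner (S' x) y = cinner x (T y)"
  then show "S' = S"
    by (rule_tac ext, rule_tac cinner_ext_left) (simp add: assms)
qed

lemma
  fixes T :: "'a::chilbert_space \<Rightarrow> 'a"
  assumes "bounded_clinear T"
  shows cinner_cadjoint_left: "cinner (cadjoint T x) y = cinner x (T y)"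
    and bounded_clinear_cadjoint: "bounded_clinear (cadjoint T)"
proof -
  obtain K where K: "0 \<le> K" "\<And>x. norm (T x) \<le> K * norm x"
    using assms by (rule bounded_clinear_bound) blast
  have "cmod (cinner x (T y)) \<le> K * norm x * norm y" for x y
    using order.trans[OF cinner_norm_le[of x "T y"] mult_left_mono[OF K(2)[of y], of "norm x"]]
    by (simp add: mult_ac)
  then obtain X where X: "bounded_clinear X" "\<And>x y. cinner x (T y) = cinner (X x) y"
    by (rule bounded_sesquilinear_form_operator[of "\<lambda>x y. cinner x (T y)" K, rotated 4])
      (auto simp: cinner_add_left cinner_scaleC_left cinner_add_right cinner_scaleC_right
        bounded_clinear_add[OF assms] bounded_clinear_scaleC[OF assms])
  then have "cadjoint T = X"
    by (intro cadjoint_eqI) simp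
  with X show "cinner (cadjoint T x) y = cinner x (T y)" "bounded_clinear (cadjoint T)"
    by auto
qed

lemma cinner_cadjoint_right:
  fixes T :: "'a::chilbert_space \<Rightarrow> 'a"
  assumes "bounded_clinear T"
  shows "cinner x (cadjoint T y) = cinner (T x) y"
  by (metis assms cinner_cadjoint_left cinner_commute)

lemma cadjoint_compose:
  fixes S T :: "'a::chilbert_space \<Rightarrow> 'a"
  assumes "bounded_clinear S" "bounded_clinear T"
  shows "cadjoint (S \<circ> T) = cadjoint T \<circ> cadjoint S"
  by (rule cadjoint_eqI) (simp add: cinner_cadjoint_left assms)

text \<open>Testing \<open>cadjoint T x\<close> against itself gives the bound multiplied by
  \<open>norm (cadjoint T x)\<close>, which is then cancelled.\<close>

lemma cadjoint_bound:
  fixes T :: "'a::chilbert_space \<Rightarrow> 'a"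
  assumes "bounded_clinear T" "\<And>x. norm (T x) \<le> K * norm x"
  shows "norm (cadjoint T x) \<le> K * norm x"
proof (cases "cadjoint T x = 0")
  case True
  have "0 \<le> K * norm x"
    using assms(2)[of x] norm_ge_zero order.trans by blast
  with True show ?thesis by simp
next
  case False
  have "(norm (cadjoint T x))\<^sup>2 = cmod (cinner x (T (cadjoint T x)))"
    by (simp add: cinner_self norm_power flip: cinner_cadjoint_left[OF assms(1)])
  also have "\<dots> \<le> norm x * norm (T (cadjoint T x))"
    by (rule cinner_norm_le)
  also have "\<dots> \<le> norm x * (K * norm (cadjoint T x))"
    by (intro mult_left_mono assms(2)) auto
  finally show ?thesis
    using False by (simp add: power2_eq_square mult_ac)
qed

lemma positive_operatorI:
  assumes "bounded_clinear T" "\<And>x. cinner (T x) x \<in> \<real>\<^sub>\<ge>\<^sub>0"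
  shows "positive_operator T"
  using assms by (simp add: positive_operator_def)

section \<open>Spectral radius\<close>

text \<open>The lower bound gives injectivity and, read for preimages, boundedness of the inverse
  with constant \<open>1 / c\<close>.\<close>

lemma invertible_operatorI:
  assumes T: "bounded_clinear T" and "surj T"
    and "0 < c" and below: "\<And>x. c * norm x \<le> norm (T x)"
  shows "invertible_operator T"
proof -
  have "x = y" if "T x = T y" for x y
    using below[of "x - y"] that \<open>0 < c\<close>
    by (simp add: bounded_clinear_diff[OF T] mult_le_0_iff)
  then have "inj T"
    by (rule injI)
  have T_inv: "T (inv T x) = x" for x
    using \<open>surj T\<close> by (simp add: surj_f_inv_f)
  have "bounded_clinear (inv T)"
  proof (rule bounded_clinearI[where K = "1 / c"])
    show "inv T (x + y) = inv T x + inv T y" for x y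
      by (rule injD[OF \<open>inj T\<close>]) (simp add: T_inv bounded_clinear_add[OF T])
    show "inv T (a *\<^sub>C x) = a *\<^sub>C inv T x" for a x
      by (rule injD[OF \<open>inj T\<close>]) (simp add: T_inv bounded_clinear_scaleC[OF T])
    show "norm (inv T x) \<le> 1 / c * norm x" for x
      using below[of "inv T x"] \<open>0 < c\<close> by (simp add: T_inv field_simps)
  qed
  moreover have "inv T \<circ> T = id" "T \<circ> inv T = id"
    using \<open>inj T\<close> T_inv by (auto simp: fun_eq_iff)
  ultimately show ?thesis
    using T by (auto simp: invertible_operator_def)
qed

lemma bounded_clinear_diff_scaleC:
  assumes "bounded_clinear T"
  shows "bounded_clinear (\<lambda>x. T x - z *\<^sub>C x)"
  using bounded_clinear_add_op[OF assms bounded_clinear_scaleC_op[OF bounded_clinear_id, of "-z"]]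
  by (simp add: scaleC_minus_left)

text \<open>Solving T x - z x = y amounts to finding a fixed point of x \<mapsto> (T x - y) / z, a
  contraction with constant \<open>K / cmod z\<close>.\<close>

lemma invertible_operator_diff_scaleC_large:
  fixes T :: "'a::chilbert_space \<Rightarrow> 'a"
  assumes T: "bounded_clinear T" and bound: "\<And>x. norm (T x) \<le> K * norm x"
    and "0 \<le> K" "K < cmod z"
  shows "invertible_operator (\<lambda>x. T x - z *\<^sub>C x)"
proof (rule invertible_operatorI)
  show "0 < cmod z - K"
    using assms by simp
  show "(cmod z - K) * norm x \<le> norm (T x - z *\<^sub>C x)" for x
    using norm_triangle_ineq2[of "z *\<^sub>C x" "T x"] bound[of x]
    by (simp add: norm_scaleC left_diff_distrib norm_minus_commute)
  have z: "z \<noteq> 0"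
    using assms by auto
  show "surj (\<lambda>x. T x - z *\<^sub>C x)"
    unfolding surj_def
  proof
    fix y
    have "\<exists>!x. (1 / z) *\<^sub>C (T x - y) = x"
    proof (rule banach_fix_type[of "K / cmod z"])
      show "0 \<le> K / cmod z" "K / cmod z < 1"
        using assms z by (auto simp: field_simps)
      have "dist ((1 / z) *\<^sub>C (T x - y)) ((1 / z) *\<^sub>C (T x' - y)) \<le> K / cmod z * dist x x'" for x x'
        using bound[of "x - x'"] z
        by (simp add: dist_norm norm_scaleC norm_divide divide_right_mono
            flip: scaleC_diff_right bounded_clinear_diff[OF T])
      then show "\<forall>x x'. dist ((1 / z) *\<^sub>C (T x - y)) ((1 / z) *\<^sub>C (T x' - y)) \<le> K / cmod z * dist x x'"
        by blast
    qed
    then obtain x where x: "(1 / z) *\<^sub>C (T x - y) = x"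
      by blast
    have "z *\<^sub>C x = T x - y"
      using arg_cong[OF x, of "\<lambda>v. z *\<^sub>C v"] z by (simp add: scaleC_scaleC)
    then have "y = T x - z *\<^sub>C x"
      by simp
    then show "\<exists>x. y = T x - z *\<^sub>C x" ..
  qed
qed (rule bounded_clinear_diff_scaleC[OF T])

text \<open>Here T x - z x = y becomes the fixed point equation x = S (y + z x), with contraction
  constant \<open>cmod z * L\<close>. It keeps the spectrum of an invertible operator away from
  0.\<close>

lemma invertible_operator_diff_scaleC_small:
  fixes T :: "'a::chilbert_space \<Rightarrow> 'a"
  assumes T: "bounded_clinear T" and S: "bounded_clinear S"
    and ST: "S \<circ> T = id" and TS: "T \<circ> S = id"
    and bound: "\<And>x. norm (S x) \<le> L * norm x" and "0 < L" "cmod z * L < 1"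
  shows "invertible_operator (\<lambda>x. T x - z *\<^sub>C x)"
proof (rule invertible_operatorI)
  have ST': "S (T x) = x" and TS': "T (S x) = x" for x
    using ST TS by (auto simp: fun_eq_iff)
  show "0 < 1 / L - cmod z"
    using \<open>0 < L\<close> \<open>cmod z * L < 1\<close> by (simp add: field_simps)
  show "(1 / L - cmod z) * norm x \<le> norm (T x - z *\<^sub>C x)" for x
  proof -
    have "norm x / L \<le> norm (T x)"
      using bound[of "T x"] \<open>0 < L\<close> by (simp add: ST' field_simps)
    then show ?thesis
      using norm_triangle_ineq2[of "T x" "z *\<^sub>C x"] by (simp add: norm_scaleC left_diff_distrib)
  qed
  show "surj (\<lambda>x. T x - z *\<^sub>C x)"
    unfolding surj_def
  proof
    fix y
    have "\<exists>!x. S (y + z *\<^sub>C x) = x"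
    proof (rule banach_fix_type[of "cmod z * L"])
      show "0 \<le> cmod z * L" "cmod z * L < 1"
        using \<open>0 < L\<close> \<open>cmod z * L < 1\<close> by auto
      have "dist (S (y + z *\<^sub>C x)) (S (y + z *\<^sub>C x')) \<le> cmod z * L * dist x x'" for x x'
        using bound[of "z *\<^sub>C (x - x')"] norm_scaleC[of z "x - x'"]
        by (simp add: dist_norm scaleC_diff_right mult_ac flip: bounded_clinear_diff[OF S])
      then show "\<forall>x x'. dist (S (y + z *\<^sub>C x)) (S (y + z *\<^sub>C x')) \<le> cmod z * L * dist x x'"
        by blast
    qed
    then obtain x where "S (y + z *\<^sub>C x) = x"
      by blast
    then have "y = T x - z *\<^sub>C x"
      using TS'[of "y + z *\<^sub>C x"] by simp
    then show "\<exists>x. y = T x - z *\<^sub>C x" ..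
  qed
qed (rule bounded_clinear_diff_scaleC[OF T])

text \<open>With empty spectrum every matrix coefficient of the resolvent would be entire and vanish
  at infinity, hence be 0 by Liouville.\<close>

lemma spectrum_nonempty:
  fixes T :: "'a::chilbert_space \<Rightarrow> 'a"
  assumes T: "bounded_clinear T" and "(x :: 'a) \<noteq> 0"
  shows "spectrum T \<noteq> {}"
proof
  assume "spectrum T = {}"
  then have "\<forall>z. \<exists>R. bounded_clinear R \<and> R \<circ> (\<lambda>x. T x - z *\<^sub>C x) = id \<and> (\<lambda>x. T x - z *\<^sub>C x) \<circ> R = id"
    by (auto simp: spectrum_def invertible_operator_def)
  then obtain R where R: "\<And>z. bounded_clinear (R z)"
    and "\<And>z. R z \<circ> (\<lambda>x. T x - z *\<^sub>C x) = id" "\<And>z. (\<lambda>x. T x - z *\<^sub>C x) \<circ> R z = id"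
    by metis
  then have left: "R z (T u - z *\<^sub>C u) = u" and right: "T (R z u) - z *\<^sub>C R z u = u" for z u
    by (auto simp: fun_eq_iff)
  have resolvent: "R z u - R w u = (z - w) *\<^sub>C R z (R w u)" for z w u
  proof -
    have "R z u - R w u = R z (T (R w u) - w *\<^sub>C R w u) - R z (T (R w u) - z *\<^sub>C R w u)"
      by (simp add: right left)
    also have "\<dots> = R z ((z - w) *\<^sub>C R w u)"
      by (simp add: scaleC_diff_left flip: bounded_clinear_diff[OF R])
    finally show ?thesis
      by (simp add: bounded_clinear_scaleC[OF R])
  qed
  obtain K where K: "0 \<le> K" "\<And>u. norm (T u) \<le> K * norm u"
    using T by (rule bounded_clinear_bound) blast
  have "cinner (R z x) y = 0" for z y
  proof (rule Liouville_weak_0[of "\<lambda>z. cinner (R z x) y"])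
    show "(\<lambda>z. cinner (R z x) y) holomorphic_on UNIV"
      unfolding holomorphic_on_def
    proof
      fix w
      obtain L where L: "0 \<le> L" "\<And>u. norm (R w u) \<le> L * norm u"
        using R by (rule bounded_clinear_bound) blast
      \<comment> \<open>A bound uniform in z near \<open>w\<close>. The radius makes
        \<open>cmod (z - w) * L\<close> at most 1/2, so that half of \<open>norm (R z u)\<close> can
        be absorbed; the summand 1 covers \<open>L = 0\<close>.\<close>
      have near: "norm (R z u) \<le> 2 * L * norm u" if "cmod (z - w) < 1 / (2 * L + 1)" for z u
      proof -
        have "R z u = R w u + (z - w) *\<^sub>C R w (R z u)"
          using resolvent[of w u z] scaleC_minus_left[of "z - w" "R w (R z u)"]
          by (simp add: algebra_simps)
        then have "norm (R z u) \<le> norm (R w u) + cmod (z - w) * norm (R w (R z u))"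
          by (metis norm_triangle_ineq norm_scaleC)
        also have "\<dots> \<le> L * norm u + cmod (z - w) * (L * norm (R z u))"
          by (intro add_mono mult_left_mono L) auto
        also have "cmod (z - w) * (L * norm (R z u)) = cmod (z - w) * L * norm (R z u)"
          by simp
        also have "\<dots> \<le> 1 / 2 * norm (R z u)"
        proof (rule mult_right_mono)
          have "cmod (z - w) * L \<le> 1 / (2 * L + 1) * L"
            by (intro mult_right_mono L less_imp_le that)
          also have "\<dots> \<le> 1 / 2"
            using L(1) by (simp add: field_simps)
          finally show "cmod (z - w) * L \<le> 1 / 2" .
        qed simp
        finally show ?thesis by simp
      qed
      define D where "D = cinner (R w (R w x)) y"
      have "((\<lambda>z. (cinner (R z x) y - cinner (R w x) y) / (z - w) - D) \<longlongrightarrow> 0) (at w)"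
      proof (rule Lim_null_comparison)
        define C where "C = 2 * L * norm (R w (R w x)) * norm y"
        have "norm ((cinner (R z x) y - cinner (R w x) y) / (z - w) - D) \<le> cmod (z - w) * C"
          if "dist z w < 1 / (2 * L + 1)" "z \<noteq> w" for z
        proof -
          \<comment> \<open>The resolvent identity is needed twice: at \<open>x\<close> for the
            difference quotient and at \<open>R w x\<close> for the distance of that quotient from
            \<open>D\<close>.\<close>
          have "cinner (R z u) y - cinner (R w u) y = (z - w) * cinner (R z (R w u)) y" for u
            by (simp add: resolvent cinner_scaleC_left flip: cinner_diff_left)
          then have "(cinner (R z x) y - cinner (R w x) y) / (z - w) - D = (z - w) * cinner (R z (R w (R w x))) y"
            using that by (simp add: D_def)
          also have "norm \<dots> \<le> cmod (z - w) * (norm (R z (R w (R w x))) * norm y)"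
            by (simp add: norm_mult mult_left_mono cinner_norm_le)
          also have "\<dots> \<le> cmod (z - w) * C"
            unfolding C_def using that
            by (intro mult_left_mono mult_right_mono near) (auto simp: dist_norm)
          finally show ?thesis .
        qed
        then show "\<forall>\<^sub>F z in at w. norm ((cinner (R z x) y - cinner (R w x) y) / (z - w) - D) \<le> cmod (z - w) * C"
          using L(1) by (auto simp: eventually_at intro!: exI[of _ "1 / (2 * L + 1)"])
        have "((\<lambda>z. cmod (z - w) * C) \<longlongrightarrow> cmod (w - w) * C) (at w)"
          by (intro tendsto_intros)
        then show "((\<lambda>z. cmod (z - w) * C) \<longlongrightarrow> 0) (at w)"
          by simp
      qed
      then have "((\<lambda>z. cinner (R z x) y) has_field_derivative D) (at w)"
        by (simp add: has_field_derivative_iff LIM_zero_iff)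
      then show "(\<lambda>z. cinner (R z x) y) field_differentiable (at w within UNIV)"
        by (auto simp: field_differentiable_def)
    qed
    show "((\<lambda>z. cinner (R z x) y) \<longlongrightarrow> 0) at_infinity"
      unfolding Lim_at_infinity
    proof (intro allI impI)
      fix e :: real assume "0 < e"
      define A where "A = norm x * norm y"
      \<comment> \<open>For \<open>cmod z > K\<close> the resolvent has norm at most 1 /
        (\<open>cmod z - K\<close>), and the threshold makes \<open>A / (cmod z - K)\<close> smaller
        than \<open>e\<close>.\<close>
      have "dist (cinner (R z x) y) 0 < e" if z: "K + 1 + A / e \<le> cmod z" for z
      proof -
        have "0 \<le> A"
          by (simp add: A_def)
        then have "A / e < cmod z - K"
          using z by simp
        then have less: "A < e * (cmod z - K)"
          using \<open>0 < e\<close> by (simp add: field_simps)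
        have "0 \<le> A / e"
          using \<open>0 \<le> A\<close> \<open>0 < e\<close> by simp
        then have pos: "0 < cmod z - K"
          using z by linarith
        have "(cmod z - K) * norm (R z x) \<le> norm x"
          using norm_triangle_ineq2[of "z *\<^sub>C R z x" "T (R z x)"] K(2)[of "R z x"] right[of z x]
          by (simp add: norm_scaleC left_diff_distrib norm_minus_commute)
        then have "(cmod z - K) * norm (R z x) * norm y \<le> A"
          by (simp add: A_def mult_right_mono)
        then have "(cmod z - K) * cmod (cinner (R z x) y) \<le> A"
          using mult_left_mono[OF cinner_norm_le[of "R z x" y] less_imp_le[OF pos]] by (simp add: mult.assoc)
        then have "(cmod z - K) * cmod (cinner (R z x) y) < (cmod z - K) * e"
          using less by (simp add: mult.commute)
        then show ?thesis
          using pos by simp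
      qed
      then show "\<exists>b. \<forall>z. b \<le> cmod z \<longrightarrow> dist (cinner (R z x) y) 0 < e"
        by blast
    qed
  qed
  \<comment> \<open>Take \<open>z = 0\<close> and \<open>y = R 0 x\<close>; then \<open>x\<close> is
    the image under \<open>T\<close> of the zero vector.\<close>
  then have "R 0 x = 0"
    using cinner_self[of "R 0 x"] by simp
  then have "x = 0"
    using right[of 0 x] bounded_clinear_zero[OF T] by simp
  with \<open>x \<noteq> 0\<close> show False ..
qed

section \<open>Spectral radius of a multiple of a unitary\<close>

lemma unitary_operator_norm:
  fixes U :: "'a::chilbert_space \<Rightarrow> 'a"
  assumes "unitary_operator U"
  shows "norm (U x) = norm x"
proof -
  have "cinner (U x) (U x) = cinner (cadjoint U (U x)) x"
    using assms by (simp add: unitary_operator_def cinner_cadjoint_left)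
  also have "cadjoint U (U x) = x"
    using assms by (simp add: unitary_operator_def fun_eq_iff)
  finally have "(norm (U x))\<^sup>2 = (norm x)\<^sup>2"
    by (simp only: cinner_self of_real_eq_iff)
  then show ?thesis
    by (rule power2_eq_imp_eq) auto
qed

text \<open>The spectrum lies on the circle of radius \<open>c\<close>: points outside are excluded
  by the norm of the operator, points inside by the norm of its inverse. The nonzero vector ensures
  that the supremum is over a nonempty set.\<close>

lemma spectral_radius_scaled_unitary:
  fixes U :: "'a::chilbert_space \<Rightarrow> 'a"
  assumes U: "unitary_operator U" and "0 < c" and "(x :: 'a) \<noteq> 0"
  shows "spectral_radius (\<lambda>v. c *\<^sub>R U v) = c"
proof -
  define T where "T v = c *\<^sub>R U v" for v
  define S where "S v = complex_of_real (1 / c) *\<^sub>C cadjoint U v" for v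
  have U': "bounded_clinear U" "\<And>v. cadjoint U (U v) = v" "\<And>v. U (cadjoint U v) = v"
    using U by (auto simp: unitary_operator_def fun_eq_iff)
  have norm: "norm (U v) = norm v" for v
    using U by (rule unitary_operator_norm)
  have T: "bounded_clinear T"
    unfolding T_def scaleR_eq_scaleC by (rule bounded_clinear_scaleC_op) fact
  have S: "bounded_clinear S"
    unfolding S_def by (intro bounded_clinear_scaleC_op bounded_clinear_cadjoint U')
  have "cmod z = c" if "z \<in> spectrum T" for z
  proof (rule ccontr)
    assume "cmod z \<noteq> c"
    then consider "c < cmod z" | "cmod z * (1 / c) < 1"
      using \<open>0 < c\<close> by (cases "c < cmod z") (auto simp: field_simps)
    then have "invertible_operator (\<lambda>v. T v - z *\<^sub>C v)"
    proof cases
      case 1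
      show ?thesis
        by (rule invertible_operator_diff_scaleC_large[OF T _ _ 1])
          (use \<open>0 < c\<close> in \<open>auto simp: T_def norm\<close>)
    next
      case 2
      show ?thesis
      proof (rule invertible_operator_diff_scaleC_small[OF T S _ _ _ _ 2])
        show "S \<circ> T = id" "T \<circ> S = id"
          using \<open>0 < c\<close> bounded_clinear_cadjoint[OF U'(1)]
          by (auto simp: fun_eq_iff T_def S_def U' bounded_clinear_scaleC bounded_clinear_scaleR scaleC_of_real
              simp del: of_real_divide)
        show "norm (S v) \<le> 1 / c * norm v" for v
          using \<open>0 < c\<close> norm[of "cadjoint U v"] by (simp add: S_def norm_scaleC U' norm_divide)
      qed (use \<open>0 < c\<close> in simp)
    qed
    with that show False
      by (simp add: spectrum_def)
  qed
  then have "cmod ` spectrum T = {c}"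
    using spectrum_nonempty[OF T \<open>x \<noteq> 0\<close>] by auto
  then show ?thesis
    by (simp add: spectral_radius_def T_def[abs_def])
qed

section \<open>Weak operator limits\<close>

text \<open>Convergence in the weak operator topology, along a filter rather than a sequence:
  passing to a finer filter takes the place of passing to a subnet.\<close>

definition wot_limit :: "('i \<Rightarrow> 'a::complex_inner \<Rightarrow> 'a) \<Rightarrow> ('a \<Rightarrow> 'a) \<Rightarrow> 'i filter \<Rightarrow> bool" where
  "wot_limit X L F \<longleftrightarrow> (\<forall>x y. ((\<lambda>i. cinner (X i x) y) \<longlongrightarrow> cinner (L x) y) F)"

lemma wot_limitD: "wot_limit X L F \<Longrightarrow> ((\<lambda>i. cinner (X i x) y) \<longlongrightarrow> cinner (L x) y) F"
  by (simp add: wot_limit_def)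

lemma wot_limit_mono: "wot_limit X L F \<Longrightarrow> G \<le> F \<Longrightarrow> wot_limit X L G"
  by (auto simp: wot_limit_def intro: tendsto_mono)

text \<open>An operator is coded by the family of its matrix coefficients, a point of a product of
  discs that is compact by Tychonoff. A cluster point inherits sesquilinearity and the bound, hence
  comes from an operator.\<close>

lemma wot_compact:
  fixes X :: "'i \<Rightarrow> 'a::chilbert_space \<Rightarrow> 'a"
  assumes "F \<noteq> bot" and X: "\<And>i. bounded_clinear (X i)"
    and bound: "\<And>i x. norm (X i x) \<le> K * norm x"
  obtains G L where "G \<le> F" "G \<noteq> bot" "bounded_clinear L" "\<And>x. norm (L x) \<le> K * norm x"
    "wot_limit X L G"
proof -
  define \<Phi> where "\<Phi> i = (\<lambda>q. cinner (X i (fst q)) (snd q))" for i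
  define S where "S = (\<Pi>\<^sub>E q\<in>UNIV. cball (0::complex) (K * norm (fst q :: 'a) * norm (snd q :: 'a)))"
  have form_bound: "cmod (cinner (X i x) y) \<le> K * norm x * norm y" for i x y
    using order.trans[OF cinner_norm_le mult_right_mono[OF bound]] by simp
  have "compactin (product_topology (\<lambda>_. euclidean) UNIV) S"
    unfolding S_def compactin_PiE by auto
  then have "compact S"
    by (simp add: euclidean_product_topology)
  moreover have "filtermap \<Phi> F \<noteq> bot"
    using \<open>F \<noteq> bot\<close> by (simp add: filtermap_bot_iff)
  moreover have "eventually (\<lambda>v. v \<in> S) (filtermap \<Phi> F)"
    by (simp add: eventually_filtermap \<Phi>_def S_def PiE_UNIV_domain Pi_iff form_bound)
  ultimately obtain l where l: "inf (nhds l) (filtermap \<Phi> F) \<noteq> bot"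
    by (auto simp: compact_filter)
  \<comment> \<open>\<open>F\<close> refined by the preimages of the neighbourhoods of the cluster
    point \<open>l\<close>; it is proper exactly because \<open>l\<close> is a cluster
    point.\<close>
  define G where "G = inf F (filtercomap \<Phi> (nhds l))"
  have "G \<noteq> bot"
  proof
    assume "G = bot"
    then have "eventually (\<lambda>_. False) G"
      by simp
    then obtain P N where P: "eventually P F" and N: "eventually N (nhds l)"
      and disjoint: "\<And>i. P i \<Longrightarrow> N (\<Phi> i) \<Longrightarrow> False"
      unfolding G_def eventually_inf eventually_filtercomap by blast
    have "eventually (\<lambda>v. \<not> N v) (filtermap \<Phi> F)"
      using P disjoint by (auto simp: eventually_filtermap intro: eventually_mono[OF P])
    with N have "eventually (\<lambda>_. False) (inf (nhds l) (filtermap \<Phi> F))"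
      unfolding eventually_inf by blast
    with l show False
      by (simp add: eventually_False)
  qed
  have "filterlim \<Phi> (nhds l) G"
    unfolding filterlim_def G_def
    by (metis filtermap_filtercomap filtermap_mono inf_le2 order.trans)
  then have "((\<lambda>i. \<Phi> i q) \<longlongrightarrow> l q) G" for q
    using continuous_on_tendsto_compose[OF continuous_on_product_coordinates[of q], of \<Phi> l G] by simp
  then have lim: "((\<lambda>i. cinner (X i x) y) \<longlongrightarrow> l (x, y)) G" for x y
    unfolding \<Phi>_def by (metis fst_conv snd_conv)
  have eqI: "l (x, y) = c" if "((\<lambda>i. cinner (X i x) y) \<longlongrightarrow> c) G" for x y c
    using tendsto_unique[OF \<open>G \<noteq> bot\<close> lim that] .
  obtain L where L: "bounded_clinear L" "\<And>x. norm (L x) \<le> K * norm x"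
    "\<And>x y. l (x, y) = cinner (L x) y"
  proof (rule bounded_sesquilinear_form_operator[of "\<lambda>x y. l (x, y)" K])
    show "l (x + x', y) = l (x, y) + l (x', y)" for x x' y
      by (rule eqI) (simp add: bounded_clinear_add[OF X] cinner_add_left tendsto_add lim)
    show "l (x, y + y') = l (x, y) + l (x, y')" for x y y'
      by (rule eqI) (simp add: cinner_add_right tendsto_add lim)
    show "l (c *\<^sub>C x, y) = c * l (x, y)" for c x y
      by (rule eqI) (simp add: bounded_clinear_scaleC[OF X] cinner_scaleC_left tendsto_mult_left lim)
    show "l (x, c *\<^sub>C y) = cnj c * l (x, y)" for c x y
      by (rule eqI) (simp add: cinner_scaleC_right tendsto_mult_left lim)
    show "cmod (l (x, y)) \<le> K * norm x * norm y" for x y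
      by (rule tendsto_upperbound[OF tendsto_norm[OF lim]]) (simp_all add: form_bound \<open>G \<noteq> bot\<close>)
  qed blast
  show thesis
  proof (rule that)
    show "wot_limit X L G"
      using lim by (simp add: wot_limit_def L)
    show "G \<le> F"
      by (simp add: G_def)
  qed fact+
qed

text \<open>The zero sequences with \<open>U = UNIV\<close> exhibit the full set of bounded
  operators as a subbasic open set.\<close>

lemma topspace_ultraweak_topology:
  "topspace (ultraweak_topology :: ('a::complex_inner \<Rightarrow> 'a) topology) = Collect bounded_clinear"
proof -
  have "Collect bounded_clinear = {T :: 'a \<Rightarrow> 'a. bounded_clinear T \<and> (\<Sum>n. cinner (T ((\<lambda>_. 0) n)) ((\<lambda>_. 0) n)) \<in> UNIV}"
    by simp
  moreover have "\<dots> \<in> {{T :: 'a \<Rightarrow> 'a. bounded_clinear T \<and> (\<Sum>n. cinner (T (x n)) (y n)) \<in> U} | x y U.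
        summable (\<lambda>n. (norm (x n))\<^sup>2) \<and> summable (\<lambda>n. (norm (y n))\<^sup>2) \<and> open U}"
    by (rule CollectI, rule exI[of _ "\<lambda>_. 0"], rule exI[of _ "\<lambda>_. 0"], rule exI[of _ UNIV]) simp
  ultimately show ?thesis
    unfolding ultraweak_topology_def topology_generated_by_topspace by blast
qed

text \<open>The uniform norm bound gives the series a summable majorant, so Tannery's theorem
  exchanges limit and sum. General open sets follow by induction over their generation from the
  subbasis.\<close>

lemma wot_limit_imp_ultraweak_limit:
  fixes X :: "'i \<Rightarrow> 'a::complex_inner \<Rightarrow> 'a"
  assumes lim: "wot_limit X L F" and "F \<noteq> bot"
    and X: "\<And>i. bounded_clinear (X i)" and L: "bounded_clinear L"
    and bound: "\<And>i x. norm (X i x) \<le> K * norm x" and "0 \<le> K"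
  shows "limitin ultraweak_topology X L F"
  unfolding limitin_def
proof (intro conjI allI impI)
  show "L \<in> topspace ultraweak_topology"
    by (simp add: topspace_ultraweak_topology L)
  have basis: "\<forall>\<^sub>F i in F. (\<Sum>n. cinner (X i (x n)) (y n)) \<in> V"
    if x: "summable (\<lambda>n. (norm (x n))\<^sup>2)" and y: "summable (\<lambda>n. (norm (y n))\<^sup>2)"
      and V: "open V" "(\<Sum>n. cinner (L (x n)) (y n)) \<in> V" for x y :: "nat \<Rightarrow> 'a" and V
  proof -
    have "norm (cinner (X i (x n)) (y n)) \<le> K * ((norm (x n))\<^sup>2 + (norm (y n))\<^sup>2)" for i n
    proof -
      have "norm (cinner (X i (x n)) (y n)) \<le> K * norm (x n) * norm (y n)"
        using order.trans[OF cinner_norm_le mult_right_mono[OF bound]] by simp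
      also have "K * norm (x n) * norm (y n) \<le> K * ((norm (x n))\<^sup>2 + (norm (y n))\<^sup>2)"
      proof -
        have "norm (x n) * norm (y n) \<le> (norm (x n))\<^sup>2 + (norm (y n))\<^sup>2"
          using sum_squares_bound[of "norm (x n)" "norm (y n)"] mult_nonneg_nonneg[OF norm_ge_zero[of "x n"] norm_ge_zero[of "y n"]]
          unfolding mult.assoc by linarith
        then show ?thesis
          unfolding mult.assoc by (rule mult_left_mono) fact
      qed
      finally show ?thesis .
    qed
    then have *: "\<forall>\<^sub>F (n, i) in at_top \<times>\<^sub>F F. norm (cinner (X i (x n)) (y n)) \<le> K * ((norm (x n))\<^sup>2 + (norm (y n))\<^sup>2)"
      by (auto intro: always_eventually)
    have "summable (\<lambda>n. K * ((norm (x n))\<^sup>2 + (norm (y n))\<^sup>2))"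
      by (intro summable_mult summable_add x y)
    then have "((\<lambda>i. \<Sum>n. cinner (X i (x n)) (y n)) \<longlongrightarrow> (\<Sum>n. cinner (L (x n)) (y n))) F"
      by (rule tannerys_theorem[OF wot_limitD[OF lim] * _ \<open>F \<noteq> bot\<close>, THEN conjunct2, THEN conjunct2])
    with V show ?thesis
      by (auto simp: tendsto_def)
  qed
  fix U assume "openin ultraweak_topology U \<and> L \<in> U"
  then have "generate_topology_on
     {{T :: 'a \<Rightarrow> 'a. bounded_clinear T \<and> (\<Sum>n. cinner (T (x n)) (y n)) \<in> U} | x y U.
        summable (\<lambda>n. (norm (x n))\<^sup>2) \<and> summable (\<lambda>n. (norm (y n))\<^sup>2) \<and> open U} U" "L \<in> U"
    by (auto simp: ultraweak_topology_def openin_topology_generated_by_iff)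
  then show "\<forall>\<^sub>F i in F. X i \<in> U"
  proof (induction rule: generate_topology_on.induct)
    case (Int a b)
    then show ?case by (simp add: eventually_conj_iff)
  next
    case (UN \<K>)
    then obtain k where k: "k \<in> \<K>" "L \<in> k" by blast
    with UN have "\<forall>\<^sub>F i in F. X i \<in> k" by blast
    with k show ?case by (auto elim: eventually_mono)
  next
    case (Basis s)
    then show ?case
      using basis X by auto
  qed simp
qed

section \<open>Finite von Neumann algebras\<close>

locale finite_vn_algebra =
  fixes M :: "('a::chilbert_space \<Rightarrow> 'a) set" and \<tau> :: "('a \<Rightarrow> 'a) \<Rightarrow> complex"
  assumes von_neumann_algebra: "von_neumann_algebra M"
    and faithful_normal_trace: "faithful_normal_trace M \<tau>"
begin

lemma bounded_clinear_mem: "A \<in> M \<Longrightarrow> bounded_clinear A"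
  using von_neumann_algebra by (auto simp: von_neumann_algebra_def)

lemma id_mem: "id \<in> M"
  and compose_mem: "A \<in> M \<Longrightarrow> B \<in> M \<Longrightarrow> A \<circ> B \<in> M"
  and add_mem: "A \<in> M \<Longrightarrow> B \<in> M \<Longrightarrow> (\<lambda>x. A x + B x) \<in> M"
  and scaleC_mem: "A \<in> M \<Longrightarrow> (\<lambda>x. c *\<^sub>C A x) \<in> M"
  and cadjoint_mem: "A \<in> M \<Longrightarrow> cadjoint A \<in> M"
  using von_neumann_algebra by (simp_all add: von_neumann_algebra_def)

lemma diff_mem: "A \<in> M \<Longrightarrow> B \<in> M \<Longrightarrow> (\<lambda>x. A x - B x) \<in> M"
  using add_mem[OF _ scaleC_mem[of B "-1"]] by (simp add: scaleC_minus_left)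

lemma zero_mem: "(\<lambda>x. 0) \<in> M"
  using scaleC_mem[OF id_mem, of 0] by simp

lemma sum_mem: "(\<And>i. i \<in> I \<Longrightarrow> A i \<in> M) \<Longrightarrow> (\<lambda>x. \<Sum>i\<in>I. A i x) \<in> M"
  by (induction I rule: infinite_finite_induct) (auto simp: zero_mem add_mem)

lemma funpow_mem: "A \<in> M \<Longrightarrow> A ^^ n \<in> M"
  by (induction n) (auto simp: id_mem compose_mem simp flip: id_def)

lemma trace_add: "A \<in> M \<Longrightarrow> B \<in> M \<Longrightarrow> \<tau> (\<lambda>x. A x + B x) = \<tau> A + \<tau> B"
  and trace_scaleC: "A \<in> M \<Longrightarrow> \<tau> (\<lambda>x. c *\<^sub>C A x) = c * \<tau> A"
  and trace_commute: "A \<in> M \<Longrightarrow> B \<in> M \<Longrightarrow> \<tau> (A \<circ> B) = \<tau> (B \<circ> A)"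
  and trace_nonneg: "A \<in> M \<Longrightarrow> positive_operator A \<Longrightarrow> \<tau> A \<in> \<real>\<^sub>\<ge>\<^sub>0"
  and trace_faithful: "A \<in> M \<Longrightarrow> positive_operator A \<Longrightarrow> \<tau> A = 0 \<Longrightarrow> A = (\<lambda>x. 0)"
  using faithful_normal_trace by (simp_all add: faithful_normal_trace_def)

lemma trace_diff: "A \<in> M \<Longrightarrow> B \<in> M \<Longrightarrow> \<tau> (\<lambda>x. A x - B x) = \<tau> A - \<tau> B"
  using trace_add[OF _ scaleC_mem[of B "-1"]] trace_scaleC[of B "-1"] by (simp add: scaleC_minus_left)

lemma trace_zero: "\<tau> (\<lambda>x. 0) = 0"
  using trace_scaleC[OF id_mem, of 0] by simp

lemma trace_sum: "(\<And>i. i \<in> I \<Longrightarrow> A i \<in> M) \<Longrightarrow> \<tau> (\<lambda>x. \<Sum>i\<in>I. A i x) = (\<Sum>i\<in>I. \<tau> (A i))"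
  by (induction I rule: infinite_finite_induct) (auto simp: trace_zero trace_add sum_mem)

text \<open>Bounded weak operator limits are ultraweak limits: closedness of \<open>M\<close> keeps
  the limit inside, and normality carries the trace along.\<close>

lemma
  assumes "\<And>i. X i \<in> M" and lim: "wot_limit X L F" and "F \<noteq> bot" and "bounded_clinear L"
    and "\<And>i x. norm (X i x) \<le> K * norm x" and "0 \<le> K"
  shows wot_limit_mem: "L \<in> M"
    and trace_wot_limit: "((\<lambda>i. \<tau> (X i)) \<longlongrightarrow> \<tau> L) F"
proof -
  have ultraweak: "limitin ultraweak_topology X L F"
    by (rule wot_limit_imp_ultraweak_limit) (use assms in \<open>auto simp: bounded_clinear_mem\<close>)
  then show "L \<in> M"
    by (rule limitin_closedin) (use assms von_neumann_algebra in \<open>auto simp: von_neumann_algebra_def\<close>)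
  with ultraweak have *: "limitin (subtopology ultraweak_topology M) X L F"
    using assms by (simp add: limitin_subtopology)
  have "limitin euclidean (\<tau> \<circ> X) (\<tau> L) F"
    by (rule continuous_map_limit[OF _ *]) (use faithful_normal_trace in \<open>simp add: faithful_normal_trace_def\<close>)
  then show "((\<lambda>i. \<tau> (X i)) \<longlongrightarrow> \<tau> L) F"
    by (simp add: o_def)
qed

lemma wot_compact_mem:
  assumes "F \<noteq> bot" and "\<And>i. X i \<in> M" and "\<And>i x. norm (X i x) \<le> K * norm x" and "0 \<le> K"
  obtains G L where "G \<le> F" "G \<noteq> bot" "L \<in> M" "wot_limit X L G"
proof -
  obtain G L where "G \<le> F" "G \<noteq> bot" "bounded_clinear L" "wot_limit X L G"
    by (rule wot_compact[of F X K]) (use assms bounded_clinear_mem that in auto)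
  with assms that wot_limit_mem show thesis
    by blast
qed

end

section \<open>Adjoints of powers\<close>

lemma cadjoint_id: "cadjoint id = (id :: 'a::chilbert_space \<Rightarrow> 'a)"
  by (rule cadjoint_eqI) simp

lemma bounded_clinear_funpow: "bounded_clinear T \<Longrightarrow> bounded_clinear (T ^^ n)"
  by (induction n) (auto simp: bounded_clinear_id bounded_clinear_compose simp flip: id_def)

lemma cadjoint_funpow:
  fixes T :: "'a::chilbert_space \<Rightarrow> 'a"
  assumes "bounded_clinear T"
  shows "cadjoint T ^^ n = cadjoint (T ^^ n)"
proof (induction n)
  case (Suc n)
  show ?case
    unfolding funpow_Suc_right[of n T] cadjoint_compose[OF bounded_clinear_funpow[OF assms] assms]
    by (simp only: funpow.simps(2) Suc)
qed (simp add: cadjoint_id flip: id_def)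

lemma cinner_funpow_cadjoint_left:
  fixes T :: "'a::chilbert_space \<Rightarrow> 'a"
  assumes "bounded_clinear T"
  shows "cinner ((cadjoint T ^^ n) x) y = cinner x ((T ^^ n) y)"
  using assms by (simp add: cadjoint_funpow cinner_cadjoint_left bounded_clinear_funpow)

lemma cinner_funpow_cadjoint_right:
  fixes T :: "'a::chilbert_space \<Rightarrow> 'a"
  assumes "bounded_clinear T"
  shows "cinner x ((cadjoint T ^^ n) y) = cinner ((T ^^ n) x) y"
  using assms by (simp add: cadjoint_funpow cinner_cadjoint_right bounded_clinear_funpow)

section \<open>From power boundedness to unitarity\<close>

context finite_vn_algebra
begin

text \<open>The defect \<open>P\<close> is a self-adjoint idempotent, and the trace property makes
  its trace tr(1) - tr(1) = 0; faithfulness does the rest.\<close>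

lemma coisometry_imp_unitary:
  assumes U: "U \<in> M" and "U \<circ> cadjoint U = id"
  shows "unitary_operator U"
proof -
  define P where "P = (\<lambda>x. id x - (cadjoint U \<circ> U) x)"
  note bU = bounded_clinear_mem[OF U]
  have UU': "U (cadjoint U x) = x" for x
    using assms by (simp add: fun_eq_iff)
  have mem: "cadjoint U \<circ> U \<in> M" "P \<in> M"
    unfolding P_def by (intro compose_mem cadjoint_mem diff_mem id_mem U)+
  have "positive_operator P"
  proof (rule positive_operatorI)
    show "bounded_clinear P"
      using mem bounded_clinear_mem by blast
    fix x
    have "cinner (P x) x = cinner (P x) (P x)"
      by (simp add: P_def cinner_diff_left cinner_diff_right cinner_cadjoint_left[OF bU]
          cinner_cadjoint_right[OF bU] bounded_clinear_diff[OF bU] UU')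
    then show "cinner (P x) x \<in> \<real>\<^sub>\<ge>\<^sub>0"
      by (simp add: cinner_self)
  qed
  moreover have "\<tau> P = 0"
    unfolding P_def
    using trace_diff[OF id_mem mem(1)] trace_commute[OF cadjoint_mem[OF U] U] assms(2) by simp
  ultimately have "P = (\<lambda>x. 0)"
    using trace_faithful mem by blast
  then have "cadjoint U \<circ> U = id"
    by (auto simp: P_def fun_eq_iff)
  with assms bU show ?thesis
    by (simp add: unitary_operator_def)
qed

text \<open>Conjugation by \<open>T\<close> only shifts \<open>D i\<close> to
  \<open>D (Suc i)\<close>; averaging turns the shift into invariance in the limit. The last
  conclusion makes P \<mapsto> tr(B P) usable as a positive functional although
  \<open>B \<circ> P\<close> need not be a positive operator.\<close>

lemma invariant_mean:
  assumes T: "T \<in> M" and bound: "\<And>n x. norm ((T ^^ n) x) \<le> K * norm x" and "0 \<le> K"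
    and below: "\<And>x. x \<noteq> 0 \<Longrightarrow> \<exists>\<delta>>0. \<forall>n. \<delta> \<le> norm ((T ^^ n) x)"
  obtains B where "B \<in> M" "\<And>x y. cinner (B x) y = cinner x (B y)"
    "\<And>x. cinner (B x) x \<in> \<real>\<^sub>\<ge>\<^sub>0" "\<And>x. x \<noteq> 0 \<Longrightarrow> cinner (B x) x \<noteq> 0"
    "cadjoint T \<circ> B \<circ> T = B"
    "\<And>P. P \<in> M \<Longrightarrow> positive_operator P \<Longrightarrow> \<tau> (B \<circ> P) \<in> \<real>\<^sub>\<ge>\<^sub>0"
proof -
  note bT = bounded_clinear_mem[OF T]
  define D where "D i = (cadjoint T ^^ i) \<circ> (T ^^ i)" for i
  define C where "C N = (\<lambda>x. complex_of_real (1 / real (Suc N)) *\<^sub>C (\<Sum>i\<le>N. D i x))" for N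
  have D_mem: "D i \<in> M" for i
    unfolding D_def by (intro compose_mem funpow_mem cadjoint_mem T)
  have C_mem: "C N \<in> M" for N
    unfolding C_def by (intro scaleC_mem sum_mem D_mem)
  have cinner_D: "cinner (D i x) y = cinner ((T ^^ i) x) ((T ^^ i) y)" for i x y
    by (simp add: D_def cinner_funpow_cadjoint_left[OF bT])
  have cinner_C: "cinner (C N x) y
      = complex_of_real (1 / real (Suc N)) * (\<Sum>i\<le>N. cinner ((T ^^ i) x) ((T ^^ i) y))" for N x y
    unfolding C_def cinner_scaleC_left cinner_sum_left cinner_D ..
  have cinner_C_self: "cinner (C N x) x
      = complex_of_real (1 / real (Suc N) * (\<Sum>i\<le>N. (norm ((T ^^ i) x))\<^sup>2))" for N x
    unfolding cinner_C cinner_self by simp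
  have C_bound: "norm (C N x) \<le> K\<^sup>2 * norm x" for N x
  proof -
    have "norm (D i x) \<le> K\<^sup>2 * norm x" for i
    proof -
      have "norm (D i x) \<le> K * norm ((T ^^ i) x)"
        unfolding D_def o_apply cadjoint_funpow[OF bT]
        by (intro cadjoint_bound bounded_clinear_funpow bT bound)
      also have "\<dots> \<le> K * (K * norm x)"
        by (intro mult_left_mono bound \<open>0 \<le> K\<close>)
      finally show ?thesis by (simp add: power2_eq_square)
    qed
    then have "norm (\<Sum>i\<le>N. D i x) \<le> (\<Sum>i\<le>N. K\<^sup>2 * norm x)"
      by (intro sum_norm_le) auto
    then show ?thesis
      unfolding C_def norm_scaleC by (simp add: field_simps norm_divide del: of_nat_Suc)
  qed
  obtain G B where G: "G \<le> sequentially" "G \<noteq> bot" and B: "bounded_clinear B"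
    and B_mem: "B \<in> M" and lim: "wot_limit C B G"
    by (rule wot_compact_mem[of sequentially C, OF sequentially_bot C_mem C_bound zero_le_power2])
      (rule that[OF _ _ bounded_clinear_mem])
  note limD = wot_limitD[OF lim]
  have sym: "cinner (B x) y = cinner x (B y)" for x y
  proof (rule tendsto_unique[OF G(2) limD])
    have "cinner (C N x) y = cnj (cinner (C N y) x)" for N
      by (simp add: cinner_C cinner_commute[symmetric])
    then show "((\<lambda>N. cinner (C N x) y) \<longlongrightarrow> cinner x (B y)) G"
      using tendsto_cnj[OF limD, of y x] by (simp add: cinner_commute[symmetric])
  qed
  have nonneg: "cinner (B x) x \<in> \<real>\<^sub>\<ge>\<^sub>0" for x
    by (rule Lim_in_closed_set[OF closed_nonneg_Reals_complex _ G(2) limD])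
      (unfold cinner_C_self, auto intro!: always_eventually divide_nonneg_nonneg sum_nonneg
        simp del: of_real_mult of_real_sum of_real_divide of_real_power)
  have pos: "cinner (B x) x \<noteq> 0" if x: "x \<noteq> 0" for x
  proof -
    obtain \<delta> where \<delta>: "0 < \<delta>" "\<And>n. \<delta> \<le> norm ((T ^^ n) x)"
      using below[OF x] by blast
    have "\<delta>\<^sup>2 \<le> Re (cinner (C N x) x)" for N
    proof -
      have "(\<Sum>i\<le>N. \<delta>\<^sup>2) \<le> (\<Sum>i\<le>N. (norm ((T ^^ i) x))\<^sup>2)"
        using \<delta> by (intro sum_mono power_mono) auto
      then show ?thesis
        unfolding cinner_C_self by (simp add: field_simps del: of_nat_Suc)
    qed
    \<comment> \<open>The lower bound on the orbit is uniform in the exponent, so it survives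
      averaging and the limit.\<close>
    then have "\<delta>\<^sup>2 \<le> Re (cinner (B x) x)"
      using tendsto_lowerbound[OF tendsto_Re[OF limD[of x x]]] G(2) by simp
    with \<delta>(1) show ?thesis
      by (auto dest: order.trans)
  qed
  have "cinner ((cadjoint T \<circ> B \<circ> T) x) y = cinner (B x) y" for x y
  proof (rule tendsto_unique[OF G(2) _ limD])
    define t where "t i = cinner ((T ^^ i) x) ((T ^^ i) y)" for i
    \<comment> \<open>The two sums differ by a shift of the index, so only the two end terms remain;
      power boundedness controls them, and division by \<open>Suc N\<close> removes them in the
      limit.\<close>
    have diff: "cinner (C N (T x)) (T y) - cinner (C N x) y
        = complex_of_real (1 / real (Suc N)) * (t (Suc N) - t 0)" for N
    proof -
      have "(\<Sum>i\<le>N. cinner ((T ^^ i) (T x)) ((T ^^ i) (T y))) = (\<Sum>i\<le>N. t (Suc i))"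
        unfolding t_def funpow_Suc_right o_apply ..
      then show ?thesis
        unfolding cinner_C right_diff_distrib[symmetric] t_def[symmetric]
        by (simp only: sum_telescope'' sum_subtractf[symmetric] sum_lessThan_telescope
            lessThan_Suc_atMost[symmetric])
    qed
    have "cmod (t i) \<le> (K * norm x) * (K * norm y)" for i
      unfolding t_def
      by (rule order.trans[OF cinner_norm_le]) (intro mult_mono bound; simp add: \<open>0 \<le> K\<close>)
    then have t_bound: "cmod (t (Suc N) - t 0) \<le> 2 * ((K * norm x) * (K * norm y))" for N
      using norm_triangle_ineq4[of "t (Suc N)" "t 0"] by (smt (verit))
    have "(\<lambda>N. cinner (C N (T x)) (T y) - cinner (C N x) y) \<longlonglongrightarrow> 0"
    proof (rule Lim_null_comparison)
      show "\<forall>\<^sub>F N in sequentially. norm (cinner (C N (T x)) (T y) - cinner (C N x) y)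
          \<le> inverse (real (Suc N)) * (2 * ((K * norm x) * (K * norm y)))"
        unfolding diff norm_mult norm_of_real inverse_eq_divide
        by (intro always_eventually allI mult_mono t_bound) (auto simp: \<open>0 \<le> K\<close>)
      show "(\<lambda>N. inverse (real (Suc N)) * (2 * ((K * norm x) * (K * norm y)))) \<longlonglongrightarrow> 0"
        by (rule tendsto_mult_left_zero[OF LIMSEQ_inverse_real_of_nat])
    qed
    then have "((\<lambda>N. cinner (C N (T x)) (T y) - cinner (C N x) y) \<longlongrightarrow> 0) G"
      using G(1) tendsto_mono by blast
    from tendsto_diff[OF limD[of "T x" "T y"] this]
    show "((\<lambda>N. cinner (C N x) y) \<longlongrightarrow> cinner ((cadjoint T \<circ> B \<circ> T) x) y) G"
      by (simp add: cinner_cadjoint_left[OF bT])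
  qed
  then have invariant: "cadjoint T \<circ> B \<circ> T = B"
    by (rule_tac ext, rule_tac cinner_ext_left)
  have "\<tau> (B \<circ> P) \<in> \<real>\<^sub>\<ge>\<^sub>0" if P: "P \<in> M" "positive_operator P" for P
  proof -
    note bP = bounded_clinear_mem[OF P(1)]
    obtain L where L: "0 \<le> L" "\<And>x. norm (P x) \<le> L * norm x"
      using bP by (rule bounded_clinear_bound) blast
    have trace_lim: "((\<lambda>N. \<tau> (C N \<circ> P)) \<longlongrightarrow> \<tau> (B \<circ> P)) G"
    proof (rule trace_wot_limit[OF _ _ G(2)])
      show "C N \<circ> P \<in> M" for N
        by (intro compose_mem C_mem P)
      show "wot_limit (\<lambda>N. C N \<circ> P) (B \<circ> P) G"
        using lim by (simp add: wot_limit_def)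
      show "bounded_clinear (B \<circ> P)"
        by (intro bounded_clinear_compose B bP)
      show "norm ((C N \<circ> P) x) \<le> K\<^sup>2 * L * norm x" for N x
        using order.trans[OF C_bound[of N "P x"] mult_left_mono[OF L(2)[of x], of "K\<^sup>2"]]
        by (simp add: mult.assoc)
      show "0 \<le> K\<^sup>2 * L"
        using L by simp
    qed
    have "\<tau> (C N \<circ> P) \<in> \<real>\<^sub>\<ge>\<^sub>0" for N
    proof -
      have "\<tau> (D i \<circ> P) \<in> \<real>\<^sub>\<ge>\<^sub>0" for i
      proof -
        \<comment> \<open>Cyclicity moves the adjoint power to the right, leaving a conjugate of
          \<open>P\<close>, which is visibly positive.\<close>
        have "\<tau> (D i \<circ> P) = \<tau> ((cadjoint T ^^ i) \<circ> ((T ^^ i) \<circ> P))"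
          by (simp add: D_def o_assoc)
        also have "\<dots> = \<tau> ((T ^^ i) \<circ> P \<circ> (cadjoint T ^^ i))"
          by (intro trace_commute compose_mem funpow_mem cadjoint_mem T P)
        also have "\<dots> \<in> \<real>\<^sub>\<ge>\<^sub>0"
        proof (rule trace_nonneg)
          show mem: "(T ^^ i) \<circ> P \<circ> (cadjoint T ^^ i) \<in> M"
            by (intro compose_mem funpow_mem cadjoint_mem T P)
          show "positive_operator ((T ^^ i) \<circ> P \<circ> (cadjoint T ^^ i))"
            using P(2) by (intro positive_operatorI bounded_clinear_mem mem)
              (simp add: positive_operator_def flip: cinner_funpow_cadjoint_right[OF bT])
        qed
        finally show ?thesis .
      qed
      moreover have "\<tau> (C N \<circ> P) = complex_of_real (1 / real (Suc N)) * (\<Sum>i\<le>N. \<tau> (D i \<circ> P))"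
      proof -
        have "\<tau> (\<lambda>x. complex_of_real (1 / real (Suc N)) *\<^sub>C (\<Sum>i\<le>N. (D i \<circ> P) x))
            = complex_of_real (1 / real (Suc N)) * \<tau> (\<lambda>x. \<Sum>i\<le>N. (D i \<circ> P) x)"
          by (intro trace_scaleC sum_mem compose_mem D_mem P)
        also have "\<tau> (\<lambda>x. \<Sum>i\<le>N. (D i \<circ> P) x) = (\<Sum>i\<le>N. \<tau> (D i \<circ> P))"
          by (intro trace_sum compose_mem D_mem P)
        finally show ?thesis
          by (simp add: C_def o_def)
      qed
      ultimately show ?thesis
        by (auto intro!: divide_nonneg_nonneg sum_nonneg simp: complex_nonneg_Reals_iff)
    qed
    then show ?thesis
      by (intro Lim_in_closed_set[OF closed_nonneg_Reals_complex _ G(2) trace_lim]) simp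
  qed
  with B_mem sym nonneg pos invariant that show thesis
    by blast
qed

text \<open>Formulated along an arbitrary filter and index map so that it can be applied again along
  the filter that a first application returns. The weight \<open>B\<close> is needed because
  invariance makes \<open>\<tau> (B \<circ> E n)\<close> constant in \<open>n\<close>, whereas no
  such identity is at hand for \<open>\<tau> (E n)\<close>.\<close>

lemma funpow_cadjoint_wot_limit_id:
  assumes T: "T \<in> M" and bound: "\<And>n x. norm ((T ^^ n) x) \<le> K * norm x" and "0 \<le> K"
    and below: "\<And>x. x \<noteq> 0 \<Longrightarrow> \<exists>\<delta>>0. \<forall>n. \<delta> \<le> norm ((T ^^ n) x)"
    and "F \<noteq> bot" and \<omega>: "(\<omega> \<longlongrightarrow> 1) F" "\<And>i. 0 \<le> \<omega> i"
    and contr: "\<And>i x. \<omega> i * norm ((T ^^ \<nu> i) x) \<le> norm x"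
  obtains G where "G \<le> F" "G \<noteq> bot" "wot_limit (\<lambda>i. (T ^^ \<nu> i) \<circ> (cadjoint T ^^ \<nu> i)) id G"
proof -
  note bT = bounded_clinear_mem[OF T]
  obtain B where B: "B \<in> M" and B_sym: "\<And>x y. cinner (B x) y = cinner x (B y)"
    and B_nonneg: "\<And>x. cinner (B x) x \<in> \<real>\<^sub>\<ge>\<^sub>0" and B_pos: "\<And>x. x \<noteq> 0 \<Longrightarrow> cinner (B x) x \<noteq> 0"
    and B_inv: "cadjoint T \<circ> B \<circ> T = B"
    and B_trace: "\<And>P. P \<in> M \<Longrightarrow> positive_operator P \<Longrightarrow> \<tau> (B \<circ> P) \<in> \<real>\<^sub>\<ge>\<^sub>0"
    by (rule invariant_mean[OF T bound \<open>0 \<le> K\<close> below], assumption) (rule that)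
  have B_inv_funpow: "(cadjoint T ^^ n) \<circ> B \<circ> (T ^^ n) = B" for n
  proof (induction n)
    case (Suc n)
    have "(cadjoint T ^^ Suc n) \<circ> B \<circ> (T ^^ Suc n) = (cadjoint T ^^ n) \<circ> (cadjoint T \<circ> B \<circ> T) \<circ> (T ^^ n)"
      unfolding funpow_Suc_right[of n "cadjoint T"] by (simp add: o_assoc)
    then show ?case
      by (simp only: B_inv Suc)
  qed simp
  define E where "E n = (T ^^ n) \<circ> (cadjoint T ^^ n)" for n
  define X where "X i = (\<lambda>x. x - complex_of_real ((\<omega> i)\<^sup>2) *\<^sub>C E (\<nu> i) x)" for i
  have E_mem: "E n \<in> M" for n
    unfolding E_def by (intro compose_mem funpow_mem cadjoint_mem T)
  have X_mem: "X i \<in> M" for i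
    unfolding X_def using diff_mem[OF id_mem scaleC_mem[OF E_mem]] by simp
  have cinner_E: "cinner (E n x) y = cinner ((cadjoint T ^^ n) x) ((cadjoint T ^^ n) y)" for n x y
    by (simp add: E_def cinner_funpow_cadjoint_right[OF bT])
  \<comment> \<open>The contraction bound must be transferred to the adjoint power:
    \<open>X i\<close> is positive precisely when the scaled adjoint power is a contraction.\<close>
  have contr': "\<omega> i * norm ((cadjoint T ^^ \<nu> i) x) \<le> norm x" for i x
  proof -
    define S where "S = (\<lambda>x. complex_of_real (\<omega> i) *\<^sub>C (T ^^ \<nu> i) x)"
    have S: "bounded_clinear S"
      unfolding S_def by (intro bounded_clinear_scaleC_op bounded_clinear_funpow bT)
    have "norm (S x) \<le> 1 * norm x" for x
      using contr \<omega>(2) by (simp add: S_def norm_scaleC)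
    then have "norm (cadjoint S x) \<le> 1 * norm x"
      by (rule cadjoint_bound[OF S])
    moreover have "cadjoint S = (\<lambda>x. complex_of_real (\<omega> i) *\<^sub>C (cadjoint T ^^ \<nu> i) x)"
      by (rule cadjoint_eqI) (simp add: S_def cinner_scaleC_left cinner_scaleC_right
          cinner_funpow_cadjoint_left[OF bT])
    ultimately show ?thesis
      using \<omega>(2) by (simp add: norm_scaleC)
  qed
  have cinner_X: "cinner (X i x) y = cinner x y - complex_of_real ((\<omega> i)\<^sup>2) * cinner (E (\<nu> i) x) y" for i x y
    by (simp add: X_def cinner_diff_left cinner_scaleC_left)
  have X_self: "cinner (X i x) x = complex_of_real ((norm x)\<^sup>2 - (\<omega> i * norm ((cadjoint T ^^ \<nu> i) x))\<^sup>2)" for i x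
    by (simp add: cinner_X cinner_E cinner_self power_mult_distrib)
  \<comment> \<open>Any bound uniform in \<open>i\<close> serves here; it is what weak compactness
    and the passage to the limit under the trace require.\<close>
  have X_bound: "norm (X i x) \<le> 2 * norm x" for i x
  proof -
    have "norm (complex_of_real ((\<omega> i)\<^sup>2) *\<^sub>C E (\<nu> i) x) = \<omega> i * (\<omega> i * norm ((T ^^ \<nu> i) ((cadjoint T ^^ \<nu> i) x)))"
      by (simp add: norm_scaleC E_def power2_eq_square norm_mult \<omega>(2) mult.assoc)
    also have "\<dots> \<le> \<omega> i * norm ((cadjoint T ^^ \<nu> i) x)"
      by (intro mult_left_mono contr \<omega>(2))
    also have "\<dots> \<le> norm x"
      by (rule contr')
    finally show ?thesis
      unfolding X_def using norm_triangle_ineq4[of x] by (smt (verit))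
  qed
  obtain G Y where G: "G \<le> F" "G \<noteq> bot" and Y: "Y \<in> M" and lim: "wot_limit X Y G"
    by (rule wot_compact_mem[of F X, OF \<open>F \<noteq> bot\<close> X_mem X_bound]) (simp, rule that)
  note bY = bounded_clinear_mem[OF Y] and bB = bounded_clinear_mem[OF B] and limD = wot_limitD[OF lim]
  have \<omega>_G: "(\<omega> \<longlongrightarrow> 1) G"
    using \<omega>(1) G(1) tendsto_mono by blast
  have Y_sym: "cinner (Y x) y = cinner x (Y y)" for x y
  proof (rule tendsto_unique[OF G(2) limD])
    have "cinner (X i x) y = cnj (cinner (X i y) x)" for i
      by (simp add: cinner_X cinner_E flip: cinner_commute)
    then show "((\<lambda>i. cinner (X i x) y) \<longlongrightarrow> cinner x (Y y)) G"
      using tendsto_cnj[OF limD, of y x] by (simp flip: cinner_commute)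
  qed
  \<comment> \<open>With \<open>Y_le\<close> below this says 0 \<le> Y \<le> 1, which is what makes
    Y - Y^2 positive.\<close>
  have Y_nonneg: "cinner (Y x) x \<in> \<real>\<^sub>\<ge>\<^sub>0" for x
  proof (rule Lim_in_closed_set[OF closed_nonneg_Reals_complex _ G(2) limD])
    show "\<forall>\<^sub>F i in G. cinner (X i x) x \<in> \<real>\<^sub>\<ge>\<^sub>0"
      unfolding X_self nonneg_Reals_of_real_iff
      using contr' \<omega>(2) by (intro always_eventually) (auto intro!: power_mono)
  qed
  have Y_le: "complex_of_real ((norm x)\<^sup>2) - cinner (Y x) x \<in> \<real>\<^sub>\<ge>\<^sub>0" for x
  proof (rule Lim_in_closed_set[OF closed_nonneg_Reals_complex _ G(2) tendsto_diff[OF tendsto_const limD]])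
    show "\<forall>\<^sub>F i in G. complex_of_real ((norm x)\<^sup>2) - cinner (X i x) x \<in> \<real>\<^sub>\<ge>\<^sub>0"
      unfolding X_self of_real_diff[symmetric] nonneg_Reals_of_real_iff
      by (intro always_eventually) auto
  qed
  have trace_E: "\<tau> (B \<circ> E n) = \<tau> B" for n
  proof -
    have "\<tau> (B \<circ> E n) = \<tau> ((B \<circ> (T ^^ n)) \<circ> (cadjoint T ^^ n))"
      by (simp add: E_def o_assoc)
    also have "\<dots> = \<tau> ((cadjoint T ^^ n) \<circ> (B \<circ> (T ^^ n)))"
      by (intro trace_commute compose_mem funpow_mem cadjoint_mem T B)
    finally show ?thesis
      using B_inv_funpow[of n] by (simp add: o_assoc)
  qed
  have trace_X: "\<tau> (B \<circ> X i) = (1 - complex_of_real ((\<omega> i)\<^sup>2)) * \<tau> B" for i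
  proof -
    have "B \<circ> X i = (\<lambda>x. B x - complex_of_real ((\<omega> i)\<^sup>2) *\<^sub>C (B \<circ> E (\<nu> i)) x)"
      by (simp add: fun_eq_iff X_def bounded_clinear_diff[OF bB] bounded_clinear_scaleC[OF bB])
    then have "\<tau> (B \<circ> X i) = \<tau> B - complex_of_real ((\<omega> i)\<^sup>2) * \<tau> (B \<circ> E (\<nu> i))"
      using trace_diff[OF B scaleC_mem[OF compose_mem[OF B E_mem]]] trace_scaleC[OF compose_mem[OF B E_mem]]
      by simp
    then show ?thesis
      by (simp add: trace_E left_diff_distrib)
  qed
  have "\<tau> (B \<circ> Y) = 0"
  proof (rule tendsto_unique[OF G(2)])
    obtain L where L: "0 \<le> L" "\<And>x. norm (B x) \<le> L * norm x"
      using bB by (rule bounded_clinear_bound) blast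
    show "((\<lambda>i. \<tau> (B \<circ> X i)) \<longlongrightarrow> \<tau> (B \<circ> Y)) G"
    proof (rule trace_wot_limit[OF _ _ G(2)])
      show "wot_limit (\<lambda>i. B \<circ> X i) (B \<circ> Y) G"
        using lim by (simp add: wot_limit_def B_sym)
      show "norm ((B \<circ> X i) x) \<le> (L * 2) * norm x" for i x
        using order.trans[OF L(2)[of "X i x"] mult_left_mono[OF X_bound[of i x] L(1)]] by simp
    qed (use L in \<open>auto intro: compose_mem B X_mem bounded_clinear_compose bB bY\<close>)
    have "((\<lambda>i. (1 - complex_of_real ((\<omega> i)\<^sup>2)) * \<tau> B) \<longlongrightarrow> (1 - complex_of_real (1\<^sup>2)) * \<tau> B) G"
      by (intro tendsto_intros \<omega>_G)
    then show "((\<lambda>i. \<tau> (B \<circ> X i)) \<longlongrightarrow> 0) G"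
      by (simp add: trace_X)
  qed
  moreover have "\<tau> (B \<circ> Y) = \<tau> (B \<circ> (Y \<circ> Y)) + \<tau> (B \<circ> (\<lambda>x. Y x - (Y \<circ> Y) x))"
  proof -
    have "B \<circ> Y = (\<lambda>x. (B \<circ> (Y \<circ> Y)) x + (B \<circ> (\<lambda>x. Y x - (Y \<circ> Y) x)) x)"
      by (simp add: fun_eq_iff flip: bounded_clinear_add[OF bB])
    then show ?thesis
      using trace_add[OF compose_mem[OF B compose_mem[OF Y Y]] compose_mem[OF B diff_mem[OF Y compose_mem[OF Y Y]]]]
      by simp
  qed
  moreover have "\<tau> (B \<circ> (Y \<circ> Y)) \<in> \<real>\<^sub>\<ge>\<^sub>0"
  proof (intro B_trace positive_operatorI bounded_clinear_compose bY compose_mem Y)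
    show "cinner ((Y \<circ> Y) x) x \<in> \<real>\<^sub>\<ge>\<^sub>0" for x
      using Y_sym[of "Y x" x] by (simp add: cinner_self)
  qed
  moreover have "\<tau> (B \<circ> (\<lambda>x. Y x - (Y \<circ> Y) x)) \<in> \<real>\<^sub>\<ge>\<^sub>0"
  proof (intro B_trace)
    show mem: "(\<lambda>x. Y x - (Y \<circ> Y) x) \<in> M"
      by (intro diff_mem compose_mem Y)
    show "positive_operator (\<lambda>x. Y x - (Y \<circ> Y) x)"
    proof (rule positive_operatorI[OF bounded_clinear_mem[OF mem]])
      fix x
      \<comment> \<open>\<open>Y - Y\<^sup>2 = Y (1 - Y) Y + (1 - Y) Y (1 - Y)\<close>\<close>
      have "cinner (Y x - (Y \<circ> Y) x) x
          = (complex_of_real ((norm (Y x))\<^sup>2) - cinner (Y (Y x)) (Y x)) + cinner (Y (x - Y x)) (x - Y x)"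
        unfolding cinner_self[symmetric]
        using Y_sym[of "Y x" x]
        by (simp add: bounded_clinear_diff[OF bY] cinner_diff_left cinner_diff_right)
      also have "\<dots> \<in> \<real>\<^sub>\<ge>\<^sub>0"
        by (intro nonneg_Reals_add_I Y_le Y_nonneg)
      finally show "cinner (Y x - (Y \<circ> Y) x) x \<in> \<real>\<^sub>\<ge>\<^sub>0" .
    qed
  qed
  \<comment> \<open>Two nonnegative reals with sum 0.\<close>
  ultimately have "\<tau> (B \<circ> (Y \<circ> Y)) = 0"
    by (auto simp: complex_nonneg_Reals_iff complex_eq_iff)
  moreover have "\<tau> (B \<circ> (Y \<circ> Y)) = \<tau> (Y \<circ> (B \<circ> Y))"
    using trace_commute[OF compose_mem[OF B Y] Y] by (simp add: o_assoc)
  moreover have "positive_operator (Y \<circ> (B \<circ> Y))"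
    using B_nonneg by (intro positive_operatorI bounded_clinear_compose bY bB) (simp add: Y_sym)
  ultimately have "Y \<circ> (B \<circ> Y) = (\<lambda>x. 0)"
    by (intro trace_faithful compose_mem B Y) auto
  then have "cinner (B (Y x)) (Y x) = 0" for x
    using Y_sym[of "B (Y x)" x] by (simp add: fun_eq_iff)
  then have Y_zero: "Y x = 0" for x
    using B_pos by blast
  \<comment> \<open>With the limit of \<open>X i\<close> now known to be 0, the definition of
    \<open>X i\<close> is solved for \<open>E (\<nu> i)\<close>; the divisor is eventually nonzero
    since \<open>\<omega>\<close> tends to 1.\<close>
  have "((\<lambda>i. cinner (E (\<nu> i) x) y) \<longlongrightarrow> cinner x y) G" for x y
  proof -
    have "((\<lambda>i. (cinner x y - cinner (X i x) y) / complex_of_real ((\<omega> i)\<^sup>2))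
        \<longlongrightarrow> (cinner x y - cinner (Y x) y) / complex_of_real (1\<^sup>2)) G"
      by (intro tendsto_intros limD \<omega>_G) auto
    moreover have "\<forall>\<^sub>F i in G. (cinner x y - cinner (X i x) y) / complex_of_real ((\<omega> i)\<^sup>2) = cinner (E (\<nu> i) x) y"
      using tendsto_imp_eventually_ne[OF \<omega>_G, of 0]
      by (auto simp: cinner_X elim: eventually_mono)
    ultimately show ?thesis
      by (simp add: Y_zero tendsto_cong)
  qed
  then show thesis
    by (intro that[OF G]) (simp add: wot_limit_def E_def)
qed

text \<open>If T^n T*^n and its successor, obtained by conjugating once more with \<open>T\<close>,
  both tend to 1 along one filter, the conjugate of the first limit equals the second, so
  \<open>T\<close> is a coisometry.\<close>

lemma unitary_operator_if_nearly_contractive_powers: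
  assumes T: "T \<in> M" and bound: "\<And>n x. norm ((T ^^ n) x) \<le> K * norm x" and "0 \<le> K"
    and below: "\<And>x. x \<noteq> 0 \<Longrightarrow> \<exists>\<delta>>0. \<forall>n. \<delta> \<le> norm ((T ^^ n) x)"
    and \<omega>: "\<And>n. 1 \<le> n \<Longrightarrow> 0 \<le> \<omega> n" "\<And>n x. 1 \<le> n \<Longrightarrow> \<omega> n * norm ((T ^^ n) x) \<le> norm x"
    and near: "\<And>\<epsilon>. 0 < \<epsilon> \<Longrightarrow> \<exists>n\<ge>1. \<bar>\<omega> n - 1\<bar> < \<epsilon> \<and> \<bar>\<omega> (Suc n) - 1\<bar> < (\<epsilon> :: real)"
  shows "unitary_operator T"
proof -
  note bT = bounded_clinear_mem[OF T]
  obtain \<nu> where \<nu>: "\<And>k. 1 \<le> \<nu> k" "\<And>k. \<bar>\<omega> (\<nu> k) - 1\<bar> < inverse (real (Suc k))"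
    "\<And>k. \<bar>\<omega> (Suc (\<nu> k)) - 1\<bar> < inverse (real (Suc k))"
    using near[of "inverse (real (Suc _))"] by (metis inverse_positive_iff_positive of_nat_0_less_iff zero_less_Suc)
  have "f \<longlonglongrightarrow> 1" if "\<And>k. \<bar>f k - 1\<bar> < inverse (real (Suc k))" for f
    by (rule LIM_zero_cancel, rule Lim_null_comparison[OF _ LIMSEQ_inverse_real_of_nat])
      (use that in \<open>auto intro!: always_eventually less_imp_le simp del: of_nat_Suc\<close>)
  then have lim: "(\<lambda>k. \<omega> (\<nu> k)) \<longlonglongrightarrow> 1" "(\<lambda>k. \<omega> (Suc (\<nu> k))) \<longlonglongrightarrow> 1"
    using \<nu> by auto
  obtain F where F: "F \<le> sequentially" "F \<noteq> bot"
    and F_lim: "wot_limit (\<lambda>k. (T ^^ \<nu> k) \<circ> (cadjoint T ^^ \<nu> k)) id F"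
    by (rule funpow_cadjoint_wot_limit_id[OF T bound \<open>0 \<le> K\<close> below sequentially_bot lim(1), of \<nu>])
      (use \<omega> \<nu>(1) in auto)
  \<comment> \<open>Choosing \<open>G\<close> finer than \<open>F\<close> makes both limits
    available along the same filter.\<close>
  obtain G where G: "G \<le> F" "G \<noteq> bot"
    and G_lim: "wot_limit (\<lambda>k. (T ^^ Suc (\<nu> k)) \<circ> (cadjoint T ^^ Suc (\<nu> k))) id G"
    by (rule funpow_cadjoint_wot_limit_id[OF T bound \<open>0 \<le> K\<close> below F(2) tendsto_mono[OF F(1) lim(2)], of "\<lambda>k. Suc (\<nu> k)"])
      (use \<omega> in \<open>auto simp del: funpow.simps\<close>)
  have "T (cadjoint T x) = x" for x
  proof (rule cinner_ext_left)
    fix y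
    have "((\<lambda>k. cinner (((T ^^ \<nu> k) \<circ> (cadjoint T ^^ \<nu> k)) (cadjoint T x)) (cadjoint T y))
        \<longlongrightarrow> cinner (cadjoint T x) (cadjoint T y)) G"
      using wot_limitD[OF wot_limit_mono[OF F_lim G(1)]] by simp
    \<comment> \<open>Moving the outer \<open>T\<close> across the inner product reduces the
      coefficient at n + 1 to one at n with fixed vectors, so the weak limit along \<open>F\<close>
      suffices.\<close>
    moreover have "cinner (((T ^^ \<nu> k) \<circ> (cadjoint T ^^ \<nu> k)) (cadjoint T x)) (cadjoint T y)
        = cinner (((T ^^ Suc (\<nu> k)) \<circ> (cadjoint T ^^ Suc (\<nu> k))) x) y" for k
      unfolding funpow_Suc_right[of _ "cadjoint T"] by (simp add: cinner_cadjoint_right[OF bT])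
    ultimately have "((\<lambda>k. cinner (((T ^^ Suc (\<nu> k)) \<circ> (cadjoint T ^^ Suc (\<nu> k))) x) y)
        \<longlongrightarrow> cinner (T (cadjoint T x)) y) G"
      by (simp only: cinner_cadjoint_right[OF bT])
    then show "cinner (T (cadjoint T x)) y = cinner x y"
      by (rule tendsto_unique[OF G(2) _ wot_limitD[OF G_lim, of x y, unfolded id_apply]])
  qed
  then show ?thesis
    using T by (intro coisometry_imp_unitary) (auto simp: fun_eq_iff)
qed

end

section \<open>Almost convergence\<close>

lemma almost_convergent_to_zero_windows:
  fixes u :: "nat \<Rightarrow> real"
  assumes u: "almost_convergent_to u 0" and "0 < \<epsilon>"
  shows "\<exists>N. \<forall>n\<ge>N. \<forall>k\<ge>1. (\<Sum>i=k..k+n. u i) < \<epsilon> * real (n + 1)"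
proof -
  define s where "s n k = norm ((1 / real (n + 1)) *\<^sub>R (\<Sum>i=k..k+n. u i) - 0)" for n k
  have "bounded (u ` {1..})"
    using u by (simp add: almost_convergent_to_def)
  \<comment> \<open>Boundedness is what makes the supremum over all windows a genuine upper bound
    for each of them.\<close>
  then obtain b where b: "\<And>i. 1 \<le> i \<Longrightarrow> norm (u i) \<le> b"
    by (auto simp: bounded_iff)
  have s_le: "s n k \<le> b" if "1 \<le> k" for n k
  proof -
    have "norm (\<Sum>i=k..k+n. u i) \<le> (\<Sum>i=k..k+n. b)"
      using that by (intro sum_norm_le b) auto
    then show ?thesis
      by (simp add: s_def field_simps)
  qed
  have "(\<lambda>n. SUP k\<in>{1..}. s n k) \<longlonglongrightarrow> 0"
    using u by (simp add: almost_convergent_to_def s_def)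
  then have "\<forall>\<^sub>F n in sequentially. (SUP k\<in>{1..}. s n k) < \<epsilon>"
    using \<open>0 < \<epsilon>\<close> by (rule order_tendstoD(2))
  then obtain N where N: "\<And>n. N \<le> n \<Longrightarrow> (SUP k\<in>{1..}. s n k) < \<epsilon>"
    by (auto simp: eventually_sequentially)
  have "(\<Sum>i=k..k+n. u i) < \<epsilon> * real (n + 1)" if "N \<le> n" "1 \<le> k" for n k
  proof -
    have "s n k \<le> (SUP k\<in>{1..}. s n k)"
      using that by (intro cSUP_upper bdd_aboveI2[of _ _ b] s_le) auto
    moreover have "(1 / real (n + 1)) * (\<Sum>i=k..k+n. u i) \<le> s n k"
      by (simp only: s_def real_scaleR_def diff_zero real_norm_def abs_ge_self)
    ultimately have "(1 / real (n + 1)) * (\<Sum>i=k..k+n. u i) < \<epsilon>"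
      using N[OF that(1)] by linarith
    then show ?thesis
      by (simp add: field_simps)
  qed
  then show ?thesis
    by blast
qed

text \<open>If every term of a window were at least \<open>\<epsilon>\<close> away from
  \<open>c\<close>, so would be the average distance. The window length does not depend on its
  position.\<close>

lemma strongly_almost_convergent_to_window_close:
  fixes w :: "nat \<Rightarrow> real"
  assumes "strongly_almost_convergent_to w c" and "0 < \<epsilon>"
  shows "\<exists>N. \<forall>k\<ge>1. \<exists>i\<in>{k..k+N}. \<bar>w i - c\<bar> < \<epsilon>"
proof -
  have "almost_convergent_to (\<lambda>n. \<bar>w n - c\<bar>) 0"
    using assms(1) by (simp add: strongly_almost_convergent_to_def)
  then obtain N where N: "\<And>k. 1 \<le> k \<Longrightarrow> (\<Sum>i=k..k+N. \<bar>w i - c\<bar>) < \<epsilon> * real (N + 1)"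
    using almost_convergent_to_zero_windows[OF _ \<open>0 < \<epsilon>\<close>] by blast
  have "\<exists>i\<in>{k..k+N}. \<bar>w i - c\<bar> < \<epsilon>" if "1 \<le> k" for k
  proof (rule ccontr)
    assume "\<not> ?thesis"
    then have "(\<Sum>i=k..k+N. \<epsilon>) \<le> (\<Sum>i=k..k+N. \<bar>w i - c\<bar>)"
      by (intro sum_mono) (auto simp: not_less)
    with N[OF that] show False
      by (simp add: mult.commute)
  qed
  then show ?thesis
    by blast
qed

text \<open>Otherwise each pair of neighbours contributes at least \<open>\<epsilon>\<close>.
  Summing over a window and its shift by one contradicts averages below
  \<open>\<epsilon> / 2\<close> on both.\<close>

lemma strongly_almost_convergent_to_consecutive_close:
  fixes w :: "nat \<Rightarrow> real"
  assumes "strongly_almost_convergent_to w c" and "0 < \<epsilon>"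
  shows "\<exists>n\<ge>1. \<bar>w n - c\<bar> < \<epsilon> \<and> \<bar>w (Suc n) - c\<bar> < \<epsilon>"
proof (rule ccontr)
  assume none: "\<not> ?thesis"
  have "almost_convergent_to (\<lambda>n. \<bar>w n - c\<bar>) 0"
    using assms(1) by (simp add: strongly_almost_convergent_to_def)
  then obtain N where N: "\<And>k. 1 \<le> k \<Longrightarrow> (\<Sum>i=k..k+N. \<bar>w i - c\<bar>) < \<epsilon> / 2 * real (N + 1)"
    using almost_convergent_to_zero_windows[of _ "\<epsilon> / 2"] \<open>0 < \<epsilon>\<close> by (meson half_gt_zero order_refl)
  have "\<epsilon> * real (N + 1) = (\<Sum>i=1..1+N. \<epsilon>)"
    by simp
  also have "\<dots> \<le> (\<Sum>i=1..1+N. \<bar>w i - c\<bar> + \<bar>w (Suc i) - c\<bar>)"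
  proof (rule sum_mono)
    fix i assume "i \<in> {1..1+N}"
    then have "\<epsilon> \<le> \<bar>w i - c\<bar> \<or> \<epsilon> \<le> \<bar>w (Suc i) - c\<bar>"
      using none by force
    then show "\<epsilon> \<le> \<bar>w i - c\<bar> + \<bar>w (Suc i) - c\<bar>"
      by auto
  qed
  also have "\<dots> = (\<Sum>i=1..1+N. \<bar>w i - c\<bar>) + (\<Sum>i=2..2+N. \<bar>w i - c\<bar>)"
    using sum.shift_bounds_cl_Suc_ivl[of "\<lambda>i. \<bar>w i - c\<bar>" 1 "1 + N"]
    by (simp add: sum.distrib numeral_2_eq_2)
  also have "\<dots> < \<epsilon> * real (N + 1)"
    using N[of 1] N[of 2] by (simp add: field_simps)
  finally show False
    by simp
qed

text \<open>Every averaged translate of a null sequence is null, so all the lower limits in the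
  supremum are 0.\<close>

lemma q_prime_eq_0:
  assumes "\<xi> \<longlonglongrightarrow> 0"
  shows "q_prime \<xi> = 0"
proof -
  have "real_of_ereal (liminf (\<lambda>k. ereal ((1 / real m) * (\<Sum>i=1..m. \<xi> (\<nu> i + k))))) = 0" for m \<nu>
  proof -
    have "(\<lambda>k. \<xi> (\<nu> i + k)) \<longlonglongrightarrow> 0" for i
      using LIMSEQ_ignore_initial_segment[OF assms, of "\<nu> i"] by (simp add: add.commute)
    then have "(\<lambda>k. (1 / real m) * (\<Sum>i=1..m. \<xi> (\<nu> i + k))) \<longlonglongrightarrow> (1 / real m) * (\<Sum>i=1..m. 0)"
      by (intro tendsto_intros)
    then have "liminf (\<lambda>k. ereal ((1 / real m) * (\<Sum>i=1..m. \<xi> (\<nu> i + k)))) = ereal 0"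
      by (intro lim_imp_Liminf) (simp_all add: tendsto_ereal)
    then show ?thesis
      by simp
  qed
  then have "{real_of_ereal (liminf (\<lambda>k. ereal ((1 / real m) * (\<Sum>i=1..m. \<xi> (\<nu> i + k))))) | m \<nu>.
     1 \<le> m \<and> (\<forall>i\<in>{1..m}. (1::nat) \<le> \<nu> i)} = {0}"
    by (auto intro!: exI[of _ "1::nat"] exI[of _ "\<lambda>_. 1::nat"])
  then show ?thesis
    by (simp add: q_prime_def)
qed

section \<open>Orbits\<close>

lemma funpow_norm_le:
  fixes T :: "'a::real_normed_vector \<Rightarrow> 'a"
  assumes "\<And>x. norm (T x) \<le> a * norm x" and "0 \<le> a"
  shows "norm ((T ^^ n) x) \<le> a ^ n * norm x"
proof (induction n)
  case (Suc n)
  have "norm ((T ^^ Suc n) x) \<le> a * norm ((T ^^ n) x)"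
    using assms by simp
  also have "\<dots> \<le> a * (a ^ n * norm x)"
    by (intro mult_left_mono Suc assms)
  finally show ?case by simp
qed simp

text \<open>Every exponent exceeds a good one by at most \<open>N\<close>, and those extra factors
  cost at most \<open>a ^ N\<close>; exponents up to \<open>N\<close> are covered by
  \<open>a ^ N\<close> alone. The maxima with 1 make both factors of \<open>K\<close> monotone
  bounds.\<close>

lemma power_bounded_if_syndetically_bounded:
  assumes T: "bounded_clinear T" and syndetic: "\<And>k. 1 \<le> k \<Longrightarrow> \<exists>i\<in>{k..k+N}. \<forall>x. norm ((T ^^ i) x) \<le> b * norm x"
  shows "\<exists>K\<ge>0. \<forall>n x. norm ((T ^^ n) x) \<le> K * norm x"
proof -
  obtain a' where a': "0 \<le> a'" "\<And>x. norm (T x) \<le> a' * norm x"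
    using T by (rule bounded_clinear_bound) blast
  define a where "a = max 1 a'"
  define K where "K = a ^ N * max 1 b"
  have a: "1 \<le> a" "norm (T x) \<le> a * norm x" for x
    using order.trans[OF a'(2) mult_right_mono[of a' a "norm x"]] by (auto simp: a_def)
  have pow: "norm ((T ^^ n) x) \<le> a ^ n * norm x" for n x
    using a by (intro funpow_norm_le) auto
  have "norm ((T ^^ n) x) \<le> K * norm x" for n x
  proof (cases "n \<le> N")
    case True
    have "a ^ n \<le> a ^ N * 1"
      using True a by (simp add: power_increasing)
    also have "\<dots> \<le> K"
      unfolding K_def using a by (intro mult_left_mono) auto
    finally show ?thesis
      using order.trans[OF pow mult_right_mono] by (metis norm_ge_zero)
  next
    case False
    then obtain i where i: "i \<in> {n - N..n - N + N}" "\<And>x. norm ((T ^^ i) x) \<le> b * norm x"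
      using syndetic[of "n - N"] by (auto simp: Suc_le_eq)
    have "n = (n - i) + i"
      using i False by simp
    then have "norm ((T ^^ n) x) = norm ((T ^^ (n - i)) ((T ^^ i) x))"
      by (metis funpow_add o_apply)
    also have "\<dots> \<le> a ^ (n - i) * norm ((T ^^ i) x)"
      by (rule pow)
    also have "\<dots> \<le> a ^ N * (max 1 b * norm x)"
    proof (rule mult_mono)
      show "a ^ (n - i) \<le> a ^ N"
        using i a False by (intro power_increasing) auto
      show "norm ((T ^^ i) x) \<le> max 1 b * norm x"
        using order.trans[OF i(2) mult_right_mono[of b "max 1 b" "norm x"]] by simp
    qed (use a in auto)
    finally show ?thesis
      by (simp add: K_def)
  qed
  moreover have "0 \<le> K"
    using a by (simp add: K_def)
  ultimately show ?thesis
    by blast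
qed

text \<open>Under power boundedness an orbit that once comes close to 0 stays close to it, so an
  orbit with infimum 0 converges to 0.\<close>

lemma orbit_bounded_below:
  fixes T :: "'a::real_normed_vector \<Rightarrow> 'a"
  assumes bound: "\<And>n x. norm ((T ^^ n) x) \<le> K * norm x" and "0 \<le> K"
    and not_null: "\<not> (\<lambda>n. (T ^^ n) x) \<longlonglongrightarrow> 0"
  shows "\<exists>\<delta>>0. \<forall>n. \<delta> \<le> norm ((T ^^ n) x)"
proof (rule ccontr)
  assume none: "\<not> ?thesis"
  have "(\<lambda>n. (T ^^ n) x) \<longlonglongrightarrow> 0"
  proof (rule LIMSEQ_I)
    fix r :: real assume "0 < r"
    \<comment> \<open>The denominator \<open>K + 1\<close> allows \<open>K = 0\<close> and keeps the
      final inequality strict.\<close>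
    then have "0 < r / (K + 1)"
      using \<open>0 \<le> K\<close> by simp
    then obtain m where m: "norm ((T ^^ m) x) < r / (K + 1)"
      using none by (meson not_le)
    have "norm ((T ^^ n) x) < r" if "m \<le> n" for n
    proof -
      have "norm ((T ^^ n) x) = norm ((T ^^ (n - m)) ((T ^^ m) x))"
        using that by (metis funpow_add le_add_diff_inverse2 o_apply)
      also have "\<dots> \<le> K * norm ((T ^^ m) x)"
        by (rule bound)
      also have "\<dots> \<le> K * (r / (K + 1))"
        by (intro mult_left_mono less_imp_le m \<open>0 \<le> K\<close>)
      also have "\<dots> < r"
        using \<open>0 < r\<close> \<open>0 \<le> K\<close> by (simp add: field_simps)
      finally show ?thesis .
    qed
    then show "\<exists>m. \<forall>n\<ge>m. norm ((T ^^ n) x - 0) < r"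
      by auto
  qed
  with not_null show False ..
qed

section \<open>Operators controlled by a regular gauge\<close>

lemma funpow_scaleC:
  assumes "bounded_clinear T"
  shows "((\<lambda>x. c *\<^sub>C T x) ^^ n) x = c ^ n *\<^sub>C (T ^^ n) x"
proof (induction n)
  case (Suc n)
  then show ?case
    by (simp add: bounded_clinear_scaleC[OF assms] scaleC_scaleC mult.commute)
qed simp

lemma control_sequence_single:
  fixes T :: "'a::chilbert_space \<Rightarrow> 'a"
  assumes "bounded_clinear T"
  shows "control_sequence p [T] x [j] = (norm ((T ^^ j) x) / p j)\<^sup>2"
  by (simp add: control_sequence_def cinner_funpow_cadjoint_left[OF assms] cinner_self power_divide)

context finite_vn_algebra
begin

proposition unitary_if_asymptotically_controlled:
  assumes p: "\<And>n. 1 \<le> n \<Longrightarrow> 0 < p n" and "0 < c"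
    and regular: "strongly_almost_convergent_to (\<lambda>n. c ^ n / p n) 1"
    and control: "asymptotically_controlled S p" and "S \<subseteq> M" and "T \<in> S"
  shows "unitary_operator (\<lambda>x. complex_of_real (1 / c) *\<^sub>C T x)"
proof -
  define U where "U = (\<lambda>x. complex_of_real (1 / c) *\<^sub>C T x)"
  define w where "w n = c ^ n / p n" for n
  have bT: "bounded_clinear T"
    using assms bounded_clinear_mem by blast
  have U: "U \<in> M"
    unfolding U_def using assms by (auto intro: scaleC_mem)
  have U_funpow: "norm ((U ^^ n) x) = norm ((T ^^ n) x) / c ^ n" for n x
    unfolding U_def funpow_scaleC[OF bT] norm_scaleC
    using \<open>0 < c\<close> by (simp add: norm_power norm_divide power_one_over)
  have w_pos: "0 < w n" if "1 \<le> n" for n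
    using p[OF that] \<open>0 < c\<close> by (simp add: w_def)
  \<comment> \<open>The powers of \<open>c\<close> cancel, so \<open>w\<close> times the orbit of
    \<open>U\<close> is the orbit of \<open>T\<close> measured by the gauge. Compatibility bounds
    this quantity above; its square is the control sequence for one operator.\<close>
  have wU: "w n * norm ((U ^^ n) x) = norm ((T ^^ n) x) / p n" for n x
    using \<open>0 < c\<close> by (simp add: w_def U_funpow)
  have contr: "w n * norm ((U ^^ n) x) \<le> norm x" if "1 \<le> n" for n x
  proof -
    have "onorm (T ^^ n) \<le> p n"
      using control \<open>T \<in> S\<close> that by (auto simp: asymptotically_controlled_def gauge_compatible_def)
    moreover have "norm ((T ^^ n) x) \<le> onorm (T ^^ n) * norm x"
      by (intro onorm bounded_clinear_bounded_linear bounded_clinear_funpow bT)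
    ultimately have "norm ((T ^^ n) x) \<le> p n * norm x"
      by (meson mult_right_mono norm_ge_zero order.trans)
    then show ?thesis
      using p[OF that] unfolding wU by (simp add: field_simps)
  qed
  have strong: "strongly_almost_convergent_to w 1"
    using regular unfolding w_def .
  obtain N where N: "\<And>k. 1 \<le> k \<Longrightarrow> \<exists>i\<in>{k..k+N}. \<bar>w i - 1\<bar> < 1 / 2"
    using strongly_almost_convergent_to_window_close[OF strong, of "1 / 2"] by auto
  \<comment> \<open>The constant 2 is the reciprocal of the bound \<open>w i\<close> > 1/2.\<close>
  have "\<exists>i\<in>{k..k+N}. \<forall>x. norm ((U ^^ i) x) \<le> 2 * norm x" if k: "1 \<le> k" for k
  proof -
    obtain i where i: "i \<in> {k..k+N}" "\<bar>w i - 1\<bar> < 1 / 2"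
      using N[OF k] by blast
    have "norm ((U ^^ i) x) \<le> 2 * norm x" for x
    proof -
      have "1 / 2 * norm ((U ^^ i) x) \<le> w i * norm ((U ^^ i) x)"
        using i(2) unfolding abs_less_iff by (intro mult_right_mono) auto
      also have "\<dots> \<le> norm x"
        using i(1) k by (intro contr) auto
      finally show ?thesis by simp
    qed
    with i(1) show ?thesis by blast
  qed
  then obtain K where K: "0 \<le> K" "\<And>n x. norm ((U ^^ n) x) \<le> K * norm x"
    using power_bounded_if_syndetically_bounded[OF bounded_clinear_mem[OF U]] by metis
  have "\<not> (\<lambda>n. (U ^^ n) x) \<longlonglongrightarrow> 0" if "x \<noteq> 0" for x
  proof
    assume null: "(\<lambda>n. (U ^^ n) x) \<longlonglongrightarrow> 0"
    have "bounded (w ` {1..})"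
      using strong by (simp add: strongly_almost_convergent_to_def)
    then obtain b where b: "\<And>i. 1 \<le> i \<Longrightarrow> norm (w i) \<le> b"
      by (auto simp: bounded_iff)
    \<comment> \<open>Since \<open>w\<close> is bounded, a null orbit of \<open>U\<close> forces a
      null control sequence, against the positive bound \<open>\<rho>\<close>.\<close>
    have "(\<lambda>n. w n * norm ((U ^^ n) x)) \<longlonglongrightarrow> 0"
    proof (rule Lim_null_comparison)
      show "\<forall>\<^sub>F n in sequentially. norm (w n * norm ((U ^^ n) x)) \<le> b * norm ((U ^^ n) x)"
        using eventually_ge_at_top[of 1]
        by eventually_elim (auto simp: abs_mult intro!: mult_right_mono b[simplified])
      show "(\<lambda>n. b * norm ((U ^^ n) x)) \<longlonglongrightarrow> 0"
        by (intro tendsto_mult_right_zero tendsto_norm_zero null)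
    qed
    then have "(\<lambda>n. (norm ((T ^^ n) x) / p n)\<^sup>2) \<longlonglongrightarrow> 0\<^sup>2"
      unfolding wU by (rule tendsto_power)
    then have "Q_tilde 1 (control_sequence p [T] x) = 0"
      by (simp add: Q_tilde_def Q_last_def control_sequence_single[OF bT] q_prime_eq_0)
    moreover obtain \<rho> where "0 < \<rho>" and \<rho>: "\<And>n Ts. \<lbrakk>1 \<le> n; length Ts = n; set Ts \<subseteq> S\<rbrakk> \<Longrightarrow> \<rho> \<le> Q_tilde n (control_sequence p Ts x)"
      using control \<open>x \<noteq> 0\<close> unfolding asymptotically_controlled_def by metis
    ultimately show False
      using \<rho>[of 1 "[T]"] \<open>T \<in> S\<close> by simp
  qed
  then have below: "\<exists>\<delta>>0. \<forall>n. \<delta> \<le> norm ((U ^^ n) x)" if "x \<noteq> 0" for x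
    using orbit_bounded_below[OF K(2,1)] that by blast
  have "unitary_operator U"
  proof (rule unitary_operator_if_nearly_contractive_powers[OF U K(2,1) below])
    show "0 \<le> w n" if "1 \<le> n" for n
      using w_pos[OF that] by simp
    show "\<exists>n\<ge>1. \<bar>w n - 1\<bar> < \<epsilon> \<and> \<bar>w (Suc n) - 1\<bar> < \<epsilon>" if "0 < \<epsilon>" for \<epsilon>
      by (rule strongly_almost_convergent_to_consecutive_close[OF strong that])
  qed (assumption, rule contr, assumption)
  then show ?thesis
    by (simp add: U_def)
qed

end

text \<open>On the zero space all operator norms are 0, which contradicts the second half of
  compatibility. A nonzero vector is what gives the spectral radius its meaning.\<close>

lemma gauge_compatible_imp_nontrivial:
  assumes "gauge_compatible (T :: 'a::complex_inner \<Rightarrow> 'a) p"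
  shows "\<exists>x :: 'a. x \<noteq> 0"
proof (rule ccontr)
  assume "\<nexists>x :: 'a. x \<noteq> 0"
  then have "onorm (T ^^ n) = 0" for n
    by (intro onorm_eq_0[THEN iffD2] bounded_clinear_bounded_linear bounded_clinear_funpow)
      (use assms in \<open>auto simp: gauge_compatible_def\<close>)
  then have "almost_convergent_to (\<lambda>n. onorm (T ^^ n) / p n) 0"
    by (simp add: almost_convergent_to_def image_constant_conv)
  with assms show False
    by (simp add: gauge_compatible_def)
qed

theorem theorem3p2:
  fixes M S :: "('a::chilbert_space \<Rightarrow> 'a) set" and p :: "nat \<Rightarrow> real"
  assumes "separable_space (euclidean :: 'a topology)"
    and "finite_von_neumann_algebra M"
    and "S \<subseteq> M"
    and "\<forall>T1\<in>S. \<forall>T2\<in>S. T1 \<circ> T2 = T2 \<circ> T1"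
    and "regular_norm_gauge p"
    and "asymptotically_controlled S p"
  shows "\<exists>A\<in>M. invertible_operator A \<and>
    (\<forall>T\<in>S. unitary_operator
       (\<lambda>x. inverse (spectral_radius T) *\<^sub>R (A \<circ> T \<circ> inv A) x))"
proof -
  obtain \<tau> where "finite_vn_algebra M \<tau>"
    using assms(2) by (auto simp: finite_von_neumann_algebra_def finite_vn_algebra_def)
  then interpret finite_vn_algebra M \<tau> .
  obtain c where gauge: "norm_gauge_with p c"
    and regular: "strongly_almost_convergent_to (\<lambda>n. c ^ n / p n) 1"
    using assms(5) by (auto simp: regular_norm_gauge_def)
  have c: "0 < c" and p: "\<And>n. 1 \<le> n \<Longrightarrow> 0 < p n"
    using gauge by (auto simp: norm_gauge_with_def)
  have "unitary_operator (\<lambda>x. inverse (spectral_radius T) *\<^sub>R T x)" if T: "T \<in> S" for T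
  proof -
    define U where "U = (\<lambda>x. complex_of_real (1 / c) *\<^sub>C T x)"
    have U: "unitary_operator U"
      unfolding U_def
      by (rule unitary_if_asymptotically_controlled[OF p c regular assms(6) assms(3) T])
    obtain x :: 'a where "x \<noteq> 0"
      using gauge_compatible_imp_nontrivial[of T p] assms(6) T by (auto simp: asymptotically_controlled_def)
    \<comment> \<open>Unitarity of \<open>U\<close> is settled before any spectrum is considered;
      the spectral radius is then read off from \<open>T\<close> as \<open>c\<close> times a
      unitary.\<close>
    have T_eq: "T = (\<lambda>x. c *\<^sub>R U x)"
      using c by (simp add: U_def scaleC_of_real del: of_real_divide)
    have "spectral_radius T = c"
      unfolding T_eq by (rule spectral_radius_scaled_unitary[OF U c \<open>x \<noteq> 0\<close>])
    then have "(\<lambda>x. inverse (spectral_radius T) *\<^sub>R T x) = U"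
      by (simp add: U_def scaleC_of_real inverse_eq_divide del: of_real_divide)
    with U show ?thesis
      by simp
  qed
  moreover have "invertible_operator (id :: 'a \<Rightarrow> 'a)"
    using bounded_clinear_id by (auto simp: invertible_operator_def)
  ultimately show ?thesis
    using id_mem by (intro bexI[of _ id]) (auto simp: o_def)
qed

end
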